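(* Let $p,q,n$ be positive integers and $a,b\in\{1,-1\}$, with $p\neq 1$ when $a^nb=1$, and $q\neq 1$ when $a=1$. Then $$\begin{aligned}\int_0^\infty\frac{\ln^{q-1}(x)\operatorname{Li}_p(bx^{2n})}{1-ax^2}\,\mathrm{d}x={}&-a^{n-1}b\,2^{-q}(q-1)!\,(1+a(-1)^{q})\,\Phi(a,q,\tfrac12)\,\Phi(a^nb,p,1)\\ &+a^{n-1}b\,(2n)^{-q}(q-1)!\sum_{j=1}^{n}\sum_{k=1}^{q}\binom{p+q-k-1}{p-1}a^j(-1)^{k}\,\Theta(b,k,2j-1,2n)\,\Phi\!\left(a^nb,p+q-k,\tfrac{2n-2j+1}{2n}\right),\end{aligned}$$ where the integral is understood as a Cauchy principal value when $b=1$ (that is, $\operatorname{Li}_p$ at arguments $>1$ is given by its principal-value integral).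
   Context: Polylogarithm: for real $x\le 1$, $\operatorname{Li}_p(x)=\frac{(-1)^{p-1}}{(p-1)!}\int_0^1\frac{x\ln^{p-1}(y)}{1-xy}\,\mathrm{d}y$; for $x>1$, $\operatorname{Li}_p(x)$ denotes the Cauchy principal value of the same integral (equivalently, the real part of the analytically continued polylogarithm). Lerch function: for $c=\pm1$, integer $q\ge1$ (with $q\neq1$ if $c=1$) and $\alpha>0$, $\Phi(c,q,\alpha)=\sum_{m=0}^\infty \frac{c^m}{(m+\alpha)^q}$. For $c=\pm1$, integer $k\ge 1$ and $0<s<r$: $\Theta(c,k,s,r)=\Phi(c,k,\tfrac{s}{r})+c(-1)^{k}\Phi(c,k,\tfrac{r-s}{r})$ if $(c,k)\ne(1,1)$, and $\Theta(1,1,s,r)=\pi\cot(\pi s/r)$. *)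

theory Defs
  imports "HOL-Analysis.Analysis"
begin

text \<open>
  Cauchy principal value of an integral over \<open>[a, b]\<close> whose integrand has a
  singularity at an interior point \<open>c\<close>.
\<close>

definition cauchy_pv :: "real \<Rightarrow> real \<Rightarrow> real \<Rightarrow> (real \<Rightarrow> real) \<Rightarrow> real" where
  "cauchy_pv a c b f =
     Lim (at_right 0) (\<lambda>\<epsilon>. integral {a..c - \<epsilon>} f + integral {c + \<epsilon>..b} f)"

text \<open>
  The integrand at the end points, where \<open>ln 0 = 0\<close> and division by zero apply, is
  irrelevant for the integral.  At \<open>p = x = 1\<close> the integral diverges, and the value is
  not meaningful.
\<close>

definition polylog :: "nat \<Rightarrow> real \<Rightarrow> real" where
  "polylog p x = (- 1) ^ (p - 1) / fact (p - 1) *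
     (if x \<le> 1 then integral {0..1} (\<lambda>y. x * ln y ^ (p - 1) / (1 - x * y))
      else cauchy_pv 0 (1 / x) 1 (\<lambda>y. x * ln y ^ (p - 1) / (1 - x * y)))"

text \<open>
  The series is summed in order, since it converges only conditionally for
  \<open>c = - 1\<close>, \<open>q = 1\<close>.
\<close>

definition lerch_phi :: "real \<Rightarrow> nat \<Rightarrow> real \<Rightarrow> real" where
  "lerch_phi c q \<alpha> = (\<Sum>m. c ^ m / (real m + \<alpha>) ^ q)"

definition lerch_theta :: "real \<Rightarrow> nat \<Rightarrow> real \<Rightarrow> real \<Rightarrow> real" where
  "lerch_theta c k s r =
     (if c = 1 \<and> k = 1 then pi * cot (pi * s / r)
      else lerch_phi c k (s / r) + c * (- 1) ^ k * lerch_phi c k ((r - s) / r))"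

end

theory Submission
  imports Defs
begin

text \<open>
  Substitute \<open>x = exp u\<close> and \<open>y = exp (- v)\<close>, the latter in the integral defining the polylogarithm.
  Up to constants the left-hand side becomes the double integral of \<open>g(u) v\<^sup>i k(2 n u - v)\<close> over all
  \<open>u\<close> and all \<open>v > 0\<close>, where \<open>i = p - 1\<close>, \<open>l = q - 1\<close>, \<open>g(u) = u\<^sup>l exp u / (1 - a exp (2 u))\<close> and
  \<open>k(z) = exp z / (1 - b exp z)\<close>.  For \<open>b = 1\<close> its singularity lies on the line \<open>2 n u = v\<close>; cutting
  out the strip \<open>\<bar>2 n u - v\<bar> \<le> \<epsilon>\<close>, which serves as a principal value in either variable, makes the
  double integral absolutely convergent.  After exchanging the integrals and a partial fraction
  decomposition, the shift \<open>z = 2 n u - v\<close> turns the inner integral into a combination of Mellin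
  integrals evaluating to \<open>\<Theta>\<close>, and the outer one gives \<open>\<Phi>\<close>.  Finally \<open>\<epsilon> \<rightarrow> 0\<close> by dominated
  convergence on both sides.
\<close>

subsection \<open>Integrals of exponential type\<close>

text \<open>For \<open>b = 1\<close> the obstacle is a majorant for the cut polylogarithm that is
  uniform in \<epsilon>. With \<open>s = 2 n u\<close>, write \<open>v ^ i\<close> as
  \<open>(v ^ i - s ^ i) + s ^ i\<close>: the first part cancels the pole at \<open>v = s\<close>,
  the second is \<open>s ^ i\<close> times the case \<open>i = 0\<close>, whose closed form is
  controlled by a logarithm singular at \<open>s = 0\<close>. Bounding this logarithm through
  \<open>\<bar>s\<bar> powr (- (1 / 2))\<close> explains the shape of the integrability test below.
  The kernel is bounded by multiples of \<open>exp (t * z)\<close> for every \<open>t\<close> in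
  \<open>[0, 1]\<close> away from its pole. The choice \<open>t = 1 / (4 n)\<close> spends half of
  the decay \<open>exp (- \<bar>u\<bar>)\<close> of \<open>g\<close> and leaves
  \<open>exp (- (t * v))\<close> for \<open>v\<close>. The partial fractions succeed because
  \<open>(a * X ^ 2) ^ n\<close> and \<open>X ^ (2 * n)\<close> differ only by the sign
  \<open>a ^ n\<close>: eliminating \<open>X\<close> leaves
  \<open>1 - a ^ n * b * exp (- v)\<close>, the origin of \<Phi>(a^n b, ...). \<Theta> arises by
  adding the contributions of \<open>z\<close> and \<open>- z\<close>; for \<open>b = 1\<close>,
  \<open>k = 1\<close> only this sum is integrable, and it gives a cotangent.\<close>

lemma poly_le_exp:
  fixes c :: real
  assumes "c > 0"
  obtains C where "C > 0" "\<And>t. t \<ge> 0 \<Longrightarrow> (1 + t) ^ m \<le> C * exp (c * t)"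
proof (cases "m = 0")
  case True
  show ?thesis
    using True assms by (intro that[of 1]) auto
next
  case False
  \<comment> \<open>Chosen so that \<open>1 + t \<le> K * (1 + c * t / m)\<close>; the m-th power of
    \<open>1 + x \<le> exp x\<close> then yields the rate \<open>c\<close>.\<close>
  define K where "K = 1 + real m / c"
  have K: "K > 0" using assms False by (simp add: K_def add_pos_nonneg)
  show ?thesis
  proof (rule that[of "K ^ m"])
    fix t :: real
    assume t: "t \<ge> 0"
    have "1 + t \<le> K * (1 + c * t / m)"
      using False assms t by (auto simp: K_def field_simps add_nonneg_nonneg)
    also have "\<dots> \<le> K * exp (c * t / m)"
      using K by (intro mult_left_mono exp_ge_add_one_self) auto
    finally have "(1 + t) ^ m \<le> (K * exp (c * t / m)) ^ m"
      using t by (intro power_mono) auto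
    also have "\<dots> = K ^ m * exp (c * t)"
      using False by (simp add: power_mult_distrib exp_of_nat_mult [symmetric])
    finally show "(1 + t) ^ m \<le> K ^ m * exp (c * t)" .
  qed (use K in auto)
qed

text \<open>Euler's Gamma integral rescaled by \<open>c\<close>. The real exponent matters:
  \<open>x = 1 / 2\<close> admits an inverse square root singularity at 0 in
  \<open>integrable_exp_dominated\<close>.\<close>

lemma has_bochner_integral_powr_exp:
  fixes c x :: real
  assumes c: "c > 0" and x: "x > 0"
  shows "has_bochner_integral lborel (\<lambda>t. indicator {0<..} t * (t powr (x - 1) * exp (- (c * t)))) (Gamma x / c powr x)"
proof -
  have *: "((\<lambda>t. t powr (x - 1) / exp t) has_integral Gamma x) {0..}"
    by (rule Gamma_integral_real[OF x])
  have "has_bochner_integral lborel (\<lambda>t. indicator {0..} t * (t powr (x - 1) / exp t)) (Gamma x)"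
  proof (rule has_bochner_integral_nn_integral)
    show "(\<integral>\<^sup>+ t. ennreal (indicator {0..} t * (t powr (x - 1) / exp t)) \<partial>lborel) = ennreal (Gamma x)"
      using nn_integral_has_integral_lebesgue[OF _ *] by (simp add: mult.commute)
  qed (use x in auto)
  from lborel_has_bochner_integral_real_affine_iff[of c _ _ 0, THEN iffD1, OF _ this] c
  have "has_bochner_integral lborel (\<lambda>t. indicator {0..} (c * t) * ((c * t) powr (x - 1) / exp (c * t))) (Gamma x / c)"
    by (simp add: field_simps)
  then have "has_bochner_integral lborel (\<lambda>t. 1 / c powr (x - 1) * (indicator {0..} (c * t) * ((c * t) powr (x - 1) / exp (c * t)))) (1 / c powr (x - 1) * (Gamma x / c))"
    by (intro has_bochner_integral_mult_right)
  moreover have "(\<lambda>t. 1 / c powr (x - 1) * (indicator {0..} (c * t) * ((c * t) powr (x - 1) / exp (c * t)))) =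
      (\<lambda>t. indicator {0<..} t * (t powr (x - 1) * exp (- (c * t))))"
    using c by (auto simp: fun_eq_iff indicator_def powr_mult exp_minus field_simps zero_le_mult_iff)
  moreover have "1 / c powr (x - 1) * (Gamma x / c) = Gamma x / c powr x"
    using c by (simp add: powr_diff)
  ultimately show ?thesis by (simp only:)
qed

lemma has_bochner_integral_power_exp:
  fixes c :: real
  assumes c: "c > 0"
  shows "has_bochner_integral lborel (\<lambda>t. indicator {0<..} t * (t ^ i * exp (- (c * t)))) (fact i / c ^ Suc i)"
proof -
  have "Gamma (real i + 1) / c powr (real i + 1) = fact i / c ^ Suc i"
    using c by (simp add: powr_add powr_realpow Gamma_fact add.commute)
  moreover have "(\<lambda>t::real. indicator {0<..} t * (t powr (real i + 1 - 1) * exp (- (c * t))) :: real) =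
        (\<lambda>t. indicator {0<..} t * (t ^ i * exp (- (c * t))))"
    by (auto simp: fun_eq_iff indicator_def powr_realpow)
  ultimately show ?thesis
    using has_bochner_integral_powr_exp[OF c, of "real i + 1"] by simp
qed

text \<open>The common test for the majorants below. Polynomial growth costs half of the exponential
  rate, and the inverse square root leaves room for a logarithm at 0. The bound is asked for only
  off the null set \<open>u = 0\<close>, where kernels with a pole take a default value.\<close>

lemma integrable_exp_dominated:
  fixes f :: "real \<Rightarrow> real"
  assumes meas: "f \<in> borel_measurable borel" and c: "c > 0"
    and le: "\<And>u. u \<noteq> 0 \<Longrightarrow> \<bar>f u\<bar> \<le> C * (1 + \<bar>u\<bar>) ^ m * (1 + \<bar>u\<bar> powr (- (1/2))) * exp (- (c * \<bar>u\<bar>))"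
  shows "integrable lborel f"
proof -
  obtain D where D: "D > 0" "\<And>t. t \<ge> 0 \<Longrightarrow> (1 + t) ^ m \<le> D * exp (c / 2 * t)"
    using poly_le_exp[of "c/2" m] c by auto
  define d where "d = c / 2"
  have d: "d > 0" using c by (simp add: d_def)
  define h where "h = (\<lambda>u::real. indicator {0<..} u * (u powr (1 - 1) * exp (- (d * u)))
       + indicator {0<..} u * (u powr (1/2 - 1) * exp (- (d * u))))"
  have h: "integrable lborel h"
    unfolding h_def
    using has_bochner_integral_powr_exp[OF d, of 1] has_bochner_integral_powr_exp[OF d, of "1/2"]
    by (intro Bochner_Integration.integrable_add) (auto simp: has_bochner_integral_iff)
  then have h': "integrable lborel (\<lambda>u. h (0 + (-1) * u))"
    by (intro lborel_integrable_real_affine) auto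
  have g: "integrable lborel (\<lambda>u. \<bar>C\<bar> * D * (h u + h (0 + (-1) * u)))"
    using h h' by auto
  show ?thesis
  proof (rule Bochner_Integration.integrable_bound[OF g])
    have "AE u in lborel. u \<noteq> (0::real)"
      by (rule AE_lborel_singleton)
    then show "AE u in lborel. norm (f u) \<le> norm (\<bar>C\<bar> * D * (h u + h (0 + (-1) * u)))"
    proof eventually_elim
      case (elim u)
      have hu: "h u + h (0 + (-1) * u) = (1 + \<bar>u\<bar> powr (- (1/2))) * exp (- (d * \<bar>u\<bar>))"
        using elim by (cases "u > 0") (auto simp: h_def algebra_simps)
      have "\<bar>f u\<bar> \<le> \<bar>C\<bar> * (1 + \<bar>u\<bar>) ^ m * (1 + \<bar>u\<bar> powr (- (1/2))) * exp (- (c * \<bar>u\<bar>))"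
        by (rule order_trans[OF le[OF elim]]) (intro mult_right_mono, auto)
      also have "\<dots> \<le> \<bar>C\<bar> * (D * exp (c / 2 * \<bar>u\<bar>)) * (1 + \<bar>u\<bar> powr (- (1/2))) * exp (- (c * \<bar>u\<bar>))"
        using D(2)[of "\<bar>u\<bar>"] by (intro mult_right_mono mult_left_mono) auto
      also have "\<dots> = \<bar>C\<bar> * D * (1 + \<bar>u\<bar> powr (- (1/2))) * (exp (c / 2 * \<bar>u\<bar>) * exp (- (c * \<bar>u\<bar>)))"
        by (simp add: algebra_simps)
      also have "exp (c / 2 * \<bar>u\<bar>) * exp (- (c * \<bar>u\<bar>)) = exp (- (d * \<bar>u\<bar>))"
        by (simp add: d_def exp_add[symmetric])
      finally show ?case
        using D(1) unfolding hu by (auto simp: algebra_simps)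
    qed
  qed (use meas in auto)
qed

lemma inverse_one_minus_exp_le:
  fixes v :: real
  assumes "v > 0"
  shows "1 / (1 - exp (- v)) \<le> (1 + v) / v"
proof -
  have "1 + v \<le> exp v" by (rule exp_ge_add_one_self)
  then have "(1 + v) * exp (- v) \<le> 1"
    by (simp add: exp_minus field_simps)
  moreover have "exp (- v) < 1" using assms by simp
  ultimately show ?thesis
    using assms by (simp add: field_simps)
qed

lemma one_minus_exp_bounds:
  fixes c v :: real
  assumes "c \<in> {1, - 1}" "v > 0"
  shows "1 - c * exp (- v) > 0" "1 - c * exp (- v) \<le> 2"
    "1 / (1 - c * exp (- v)) \<le> (1 + v) / v"
    "c = - 1 \<Longrightarrow> 1 / (1 - c * exp (- v)) \<le> 1"
proof -
  have e: "0 < exp (- v)" "exp (- v) < 1" using assms by auto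
  show "1 - c * exp (- v) > 0" "1 - c * exp (- v) \<le> 2"
    using assms(1) e by (auto intro: less_trans[of _ 0] order_trans[of _ 0])
  show 1: "1 / (1 - c * exp (- v)) \<le> 1" if "c = - 1"
    using that e by (simp add: field_simps add_pos_pos)
  show "1 / (1 - c * exp (- v)) \<le> (1 + v) / v"
  proof (cases "c = 1")
    case True
    then show ?thesis using inverse_one_minus_exp_le[OF assms(2)] by simp
  next
    case False
    then have "1 / (1 - c * exp (- v)) \<le> 1" using 1 assms by auto
    also have "\<dots> \<le> (1 + v) / v" using assms(2) by (simp add: divide_simps)
    finally show ?thesis .
  qed
qed

text \<open>The partial sums of the geometric series are dominated uniformly, which
  also covers the conditionally convergent case.\<close>

lemma geometric_integral_sums:
  fixes G :: "real \<Rightarrow> real"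
  assumes c: "c \<in> {1, - 1}" and [measurable]: "G \<in> borel_measurable borel"
    and int: "integrable lborel (\<lambda>v. indicator {0<..} v * (G v / (1 - c * exp (- v))))"
  shows "(\<lambda>m. c ^ m * integral\<^sup>L lborel (\<lambda>v. indicator {0<..} v * (G v * exp (- (real m * v)))))
           sums integral\<^sup>L lborel (\<lambda>v. indicator {0<..} v * (G v / (1 - c * exp (- v))))"
proof -
  define f where "f = (\<lambda>v. indicator {0<..} v * (G v / (1 - c * exp (- v))) :: real)"
  have f: "integrable lborel f" using int by (simp add: f_def)
  have c1: "\<bar>c\<bar> = 1" using c by auto
  have meas[measurable]: "f \<in> borel_measurable borel" using f by auto
  \<comment> \<open>Integrability of the quotient suffices: for \<open>v > 0\<close>,
    \<open>1 - c * exp (- v) \<le> 2\<close> gives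
    \<open>\<bar>G v\<bar> \<le> 2 * \<bar>f v\<bar>\<close>.\<close>
  have intm: "integrable lborel (\<lambda>v. indicator {0<..} v * (G v * exp (- (real m * v))))" for m
  proof (rule Bochner_Integration.integrable_bound[of _ "\<lambda>v. 2 * f v"])
    have "\<bar>indicator {0<..} v * (G v * exp (- (real m * v)))\<bar> \<le> \<bar>2 * f v\<bar>" for v :: real
    proof (cases "v > 0")
      case True
      have "\<bar>G v * exp (- (real m * v))\<bar> \<le> \<bar>G v\<bar> * 1"
        unfolding abs_mult using True by (intro mult_mono) auto
      also have "\<bar>G v\<bar> = \<bar>f v\<bar> * (1 - c * exp (- v))"
        using one_minus_exp_bounds(1)[OF c True] True by (simp add: f_def)
      also have "\<dots> \<le> \<bar>f v\<bar> * 2"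
        using one_minus_exp_bounds(2)[OF c True] by (intro mult_left_mono) auto
      finally show ?thesis using True by simp
    qed (auto simp: f_def)
    then show "AE v in lborel. norm (indicator {0<..} v * (G v * exp (- (real m * v)))) \<le> norm (2 * f v)"
      by auto
  qed (use f in auto)
  have partial: "(\<Sum>m<N. c ^ m * integral\<^sup>L lborel (\<lambda>v. indicator {0<..} v * (G v * exp (- (real m * v)))))
      = integral\<^sup>L lborel (\<lambda>v. f v * (1 - (c * exp (- v)) ^ N))" for N
  proof -
    have "(\<Sum>m<N. c ^ m * integral\<^sup>L lborel (\<lambda>v. indicator {0<..} v * (G v * exp (- (real m * v)))))
        = integral\<^sup>L lborel (\<lambda>v. \<Sum>m<N. c ^ m * (indicator {0<..} v * (G v * exp (- (real m * v)))))"
      using intm by (subst Bochner_Integration.integral_sum) auto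
    also have "\<dots> = integral\<^sup>L lborel (\<lambda>v. f v * (1 - (c * exp (- v)) ^ N))"
    proof (rule Bochner_Integration.integral_cong[OF refl])
      fix v :: real
      show "(\<Sum>m<N. c ^ m * (indicator {0<..} v * (G v * exp (- (real m * v))))) = f v * (1 - (c * exp (- v)) ^ N)"
      proof (cases "v > 0")
        case True
        have "(\<Sum>m<N. c ^ m * (indicator {0<..} v * (G v * exp (- (real m * v))))) = G v * (\<Sum>m<N. (c * exp (- v)) ^ m)"
          using True by (simp add: sum_distrib_left power_mult_distrib exp_of_nat_mult[symmetric] algebra_simps)
        also have "(\<Sum>m<N. (c * exp (- v)) ^ m) = (1 - (c * exp (- v)) ^ N) / (1 - c * exp (- v))"
          using one_minus_exp_bounds(1)[OF c True] by (subst sum_gp_strict) auto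
        finally show ?thesis using True by (simp add: f_def)
      qed (auto simp: f_def)
    qed
    finally show ?thesis .
  qed
  have "(\<lambda>N. integral\<^sup>L lborel (\<lambda>v. f v * (1 - (c * exp (- v)) ^ N))) \<longlonglongrightarrow> integral\<^sup>L lborel f"
  proof (rule integral_dominated_convergence[where w = "\<lambda>v. 2 * \<bar>f v\<bar>"])
    have "(\<lambda>N. f v * (1 - (c * exp (- v)) ^ N)) \<longlonglongrightarrow> f v" for v
    proof (cases "v > 0")
      case True
      then have "(\<lambda>N. f v * (1 - (c * exp (- v)) ^ N)) \<longlonglongrightarrow> f v * (1 - 0)"
        by (intro tendsto_intros LIMSEQ_power_zero) (auto simp: abs_mult c1)
      then show ?thesis by simp
    qed (auto simp: f_def)
    then show "AE v in lborel. (\<lambda>N. f v * (1 - (c * exp (- v)) ^ N)) \<longlonglongrightarrow> f v" by auto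
    have "\<bar>f v * (1 - (c * exp (- v)) ^ N)\<bar> \<le> 2 * \<bar>f v\<bar>" for v N
    proof (cases "v > 0")
      case True
      have "\<bar>(c * exp (- v)) ^ N\<bar> \<le> 1"
        using True by (auto simp: power_abs abs_mult c1 intro!: power_le_one)
      then have "\<bar>f v\<bar> * \<bar>1 - (c * exp (- v)) ^ N\<bar> \<le> \<bar>f v\<bar> * 2"
        by (intro mult_left_mono) auto
      then show ?thesis by (simp add: abs_mult)
    qed (auto simp: f_def)
    then show "AE v in lborel. norm (f v * (1 - (c * exp (- v)) ^ N)) \<le> 2 * \<bar>f v\<bar>" for N
      by auto
  qed (use f in auto)
  then show ?thesis
    unfolding sums_def partial by (simp add: f_def)
qed

section \<open>Lerch functions as integrals\<close>

lemma integrable_lerch: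
  fixes \<alpha> :: real
  assumes c: "c \<in> {1, - 1}" and ci: "c = 1 \<Longrightarrow> i \<noteq> 0" and \<alpha>: "\<alpha> > 0"
  shows "integrable lborel (\<lambda>v. indicator {0<..} v * (v ^ i * exp (- (\<alpha> * v)) / (1 - c * exp (- v))))"
proof (rule integrable_exp_dominated[OF _ \<alpha>, where C = 1 and m = i])
  fix u :: real
  show "\<bar>indicator {0<..} u * (u ^ i * exp (- (\<alpha> * u)) / (1 - c * exp (- u)))\<bar>
         \<le> 1 * (1 + \<bar>u\<bar>) ^ i * (1 + \<bar>u\<bar> powr - (1 / 2)) * exp (- (\<alpha> * \<bar>u\<bar>))"
  proof (cases "u > 0")
    case True
    note b = one_minus_exp_bounds[OF c True]
    \<comment> \<open>For \<open>i > 0\<close> one factor \<open>u\<close> cancels the possible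
      simple pole at 0; for \<open>i = 0\<close> only \<open>c = - 1\<close> remains, where the
      denominator is at least 1.\<close>
    have *: "u ^ i * (1 / (1 - c * exp (- u))) \<le> (1 + u) ^ i"
    proof (cases i)
      case 0
      then show ?thesis using b(4) ci c by auto
    next
      case (Suc j)
      have "u ^ i * (1 / (1 - c * exp (- u))) \<le> u ^ i * ((1 + u) / u)"
        using b True by (intro mult_left_mono) auto
      also have "\<dots> = u ^ j * (1 + u)" using True Suc by simp
      also have "\<dots> \<le> (1 + u) ^ j * (1 + u)"
        using True by (intro mult_right_mono power_mono) auto
      finally show ?thesis using Suc by (simp add: mult.commute)
    qed
    have "\<bar>indicator {0<..} u * (u ^ i * exp (- (\<alpha> * u)) / (1 - c * exp (- u)))\<bar>
        = (u ^ i * (1 / (1 - c * exp (- u)))) * 1 * exp (- (\<alpha> * u))"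
      using True b(1) by simp
    also have "\<dots> \<le> (1 + u) ^ i * (1 + \<bar>u\<bar> powr - (1 / 2)) * exp (- (\<alpha> * u))"
      using * True b(1) by (intro mult_right_mono mult_mono) auto
    finally show ?thesis using True by simp
  qed auto
qed auto

text \<open>Expand \<open>1 / (1 - c * exp (- v))\<close> in powers of \<open>c * exp (- v)\<close>
  and apply Euler's integral to each term. The exponent \<open>i\<close> is one less than the order
  of the Lerch function.\<close>

lemma has_bochner_integral_lerch:
  fixes \<alpha> :: real
  assumes c: "c \<in> {1, - 1}" and ci: "c = 1 \<Longrightarrow> i \<noteq> 0" and \<alpha>: "\<alpha> > 0"
  shows "has_bochner_integral lborel (\<lambda>v. indicator {0<..} v * (v ^ i * exp (- (\<alpha> * v)) / (1 - c * exp (- v))))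
           (fact i * lerch_phi c (Suc i) \<alpha>)"
proof -
  have term_eq: "integral\<^sup>L lborel (\<lambda>v. indicator {0<..} v * (v ^ i * exp (- (\<alpha> * v)) * exp (- (real m * v))))
      = fact i / (real m + \<alpha>) ^ Suc i" for m
    using has_bochner_integral_integral_eq[OF has_bochner_integral_power_exp[of "real m + \<alpha>" i]] \<alpha>
    by (simp add: mult.assoc exp_add[symmetric] algebra_simps)
  have "(\<lambda>m. c ^ m * (fact i / (real m + \<alpha>) ^ Suc i)) sums
      integral\<^sup>L lborel (\<lambda>v. indicator {0<..} v * (v ^ i * exp (- (\<alpha> * v)) / (1 - c * exp (- v))))"
    using geometric_integral_sums[OF c, of "\<lambda>v. v ^ i * exp (- (\<alpha> * v))"] integrable_lerch[OF assms]
    unfolding term_eq by simp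
  then have "(\<lambda>m. (1 / fact i) * (c ^ m * (fact i / (real m + \<alpha>) ^ Suc i))) sums
      ((1 / fact i) * integral\<^sup>L lborel (\<lambda>v. indicator {0<..} v * (v ^ i * exp (- (\<alpha> * v)) / (1 - c * exp (- v)))))"
    by (rule sums_mult)
  then have "lerch_phi c (Suc i) \<alpha> = (1 / fact i) *
      integral\<^sup>L lborel (\<lambda>v. indicator {0<..} v * (v ^ i * exp (- (\<alpha> * v)) / (1 - c * exp (- v))))"
    unfolding lerch_phi_def by (intro sums_unique[symmetric]) (simp add: mult.commute)
  then show ?thesis
    using integrable_lerch[OF assms] by (simp add: has_bochner_integral_iff)
qed

section \<open>The cotangent case\<close>

lemma Digamma_reflection_real:
  fixes x :: real
  assumes x: "0 < x" "x < 1"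
  shows "Digamma (1 - x) - Digamma x = pi * cot (pi * x)"
proof -
  \<comment> \<open>An identity of functions is needed here, since the claim results from
    differentiating both sides at \<open>x\<close>.\<close>
  have refl: "Gamma t * Gamma (1 - t) = pi / sin (pi * t)" for t :: real
  proof -
    have "complex_of_real (Gamma t * Gamma (1 - t)) = complex_of_real (pi / sin (pi * t))"
    proof -
      have eqs: "of_real pi * of_real t = (of_real (pi * t) :: complex)" "1 - of_real t = (of_real (1 - t) :: complex)"
        by (simp_all only: of_real_mult of_real_diff of_real_1)
      have "complex_of_real (Gamma t) * of_real (Gamma (1 - t)) = of_real pi / of_real (sin (pi * t))"
        using Gamma_reflection_complex[of "complex_of_real t"]
        unfolding eqs Gamma_complex_of_real sin_of_real .
      then show ?thesis by (simp only: of_real_mult of_real_divide)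
    qed
    then show ?thesis by (rule of_real_eq_iff[THEN iffD1])
  qed
  have sn: "sin (pi * x) > 0"
    using x by (intro sin_gt_zero) (auto simp: field_simps)
  have nn: "y \<notin> \<int>\<^sub>\<le>\<^sub>0" if "y > 0" for y :: real
    using that by (auto elim!: nonpos_Ints_cases)
  have 1: "((\<lambda>t. Gamma t * Gamma (1 - t)) has_field_derivative
      (Gamma x * Gamma (1 - x) * (Digamma x - Digamma (1 - x)))) (at x)"
    using x nn by (auto intro!: derivative_eq_intros simp: algebra_simps)
  have 2: "((\<lambda>t. pi / sin (pi * t)) has_field_derivative
      (- (pi * (pi * cos (pi * x))) / (sin (pi * x))\<^sup>2)) (at x)"
    using sn by (auto intro!: derivative_eq_intros simp: power2_eq_square)
  have "Gamma x * Gamma (1 - x) * (Digamma x - Digamma (1 - x)) = - (pi * (pi * cos (pi * x))) / (sin (pi * x))\<^sup>2"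
    using 1 2 unfolding refl by (rule DERIV_unique)
  then have "pi / sin (pi * x) * (Digamma x - Digamma (1 - x)) = pi / sin (pi * x) * (- pi * cot (pi * x))"
    unfolding refl by (simp add: cot_def power2_eq_square)
  then have "Digamma x - Digamma (1 - x) = - pi * cot (pi * x)"
    using sn by (subst (asm) mult_cancel_left) auto
  then show ?thesis by simp
qed

text \<open>In the difference of the two Digamma series the harmonic terms and the Euler-Mascheroni
  constant cancel; the reflection formula evaluates what is left.\<close>

lemma cot_sums:
  fixes \<alpha> :: real
  assumes "0 < \<alpha>" "\<alpha> < 1"
  shows "(\<lambda>m. 1 / (real m + \<alpha>) - 1 / (real m + (1 - \<alpha>))) sums (pi * cot (pi * \<alpha>))"
proof -
  have D: "(\<lambda>n. inverse (real (Suc n)) - inverse (z + real n)) sums (Digamma z + euler_mascheroni)"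
    if "z > 0" for z :: real
    using summable_Digamma[of z] that by (simp add: Digamma_def summable_sums)
  show ?thesis
    using sums_diff[OF D[of "1 - \<alpha>"] D[of \<alpha>]] assms
    by (simp add: Digamma_reflection_real[symmetric] inverse_eq_divide add.commute)
qed

text \<open>The counterpart of \<open>has_bochner_integral_lerch\<close> for \<open>c = 1\<close>
  and order one. Each exponential alone leaves a pole at 0, and only the difference is integrable;
  hence the separate cotangent clause in \<Theta>.\<close>

lemma has_bochner_integral_cot:
  fixes \<alpha> :: real
  assumes \<alpha>: "0 < \<alpha>" "\<alpha> < 1"
  shows "has_bochner_integral lborel
      (\<lambda>v. indicator {0<..} v * ((exp (- (\<alpha> * v)) - exp (- ((1 - \<alpha>) * v))) / (1 - exp (- v))))
      (pi * cot (pi * \<alpha>))"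
proof -
  let ?G = "\<lambda>v. exp (- (\<alpha> * v)) - exp (- ((1 - \<alpha>) * v))"
  define d where "d = min \<alpha> (1 - \<alpha>)"
  have d: "d > 0" using \<alpha> by (simp add: d_def)
  have int: "integrable lborel (\<lambda>v. indicator {0<..} v * (?G v / (1 - exp (- v))))"
  proof (rule integrable_exp_dominated[OF _ d, where C = 1 and m = 1])
    fix u :: real
    show "\<bar>indicator {0<..} u * (?G u / (1 - exp (- u)))\<bar>
         \<le> 1 * (1 + \<bar>u\<bar>) ^ 1 * (1 + \<bar>u\<bar> powr - (1 / 2)) * exp (- (d * \<bar>u\<bar>))"
    proof (cases "u > 0")
      case True
      \<comment> \<open>With the slower exponential factored out,
        \<open>1 - exp (- x) \<le> x\<close> produces the factor \<open>u\<close> that cancels the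
        pole.\<close>
      have aux: "exp (- (d * u)) - exp (- (e * u)) \<le> u * exp (- (d * u))" if "d \<le> e" "e \<le> 1" for e
      proof -
        have "1 - u \<le> 1 - (e - d) * u"
          using that d True by (simp add: mult_left_le_one_le)
        also have "\<dots> \<le> exp (- ((e - d) * u))"
          using exp_ge_add_one_self[of "- ((e - d) * u)"] by simp
        finally have "exp (- (d * u)) * (1 - exp (- ((e - d) * u))) \<le> exp (- (d * u)) * u"
          by (intro mult_left_mono) auto
        moreover have "exp (- (d * u)) * exp (- ((e - d) * u)) = exp (- (e * u))"
          by (simp add: exp_add[symmetric] algebra_simps)
        ultimately show ?thesis by (simp add: algebra_simps)
      qed
      have "\<bar>?G u\<bar> \<le> u * exp (- (d * u))"
      proof (cases "\<alpha> \<le> 1 - \<alpha>")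
        case t: True
        then have "exp (- ((1 - \<alpha>) * u)) \<le> exp (- (\<alpha> * u))" using True by simp
        then show ?thesis using aux[of "1 - \<alpha>"] t \<alpha> by (simp add: d_def min_def)
      next
        case f: False
        then have "exp (- ((1 - \<alpha>) * u)) \<ge> exp (- (\<alpha> * u))" using True by simp
        then show ?thesis using aux[of "\<alpha>"] f \<alpha> by (simp add: d_def min_def)
      qed
      then have "\<bar>?G u\<bar> * (1 / (1 - exp (- u))) \<le> u * exp (- (d * u)) * ((1 + u) / u)"
        using inverse_one_minus_exp_le[OF True] True by (intro mult_mono) auto
      also have "\<dots> = (1 + u) * 1 * exp (- (d * u))" using True by simp
      also have "\<dots> \<le> (1 + u) * (1 + \<bar>u\<bar> powr - (1 / 2)) * exp (- (d * u))"
        using True by (intro mult_right_mono mult_left_mono) auto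
      finally show ?thesis using True by simp
    qed auto
  qed auto
  have hb: "has_bochner_integral lborel (\<lambda>v. indicator {0<..} v * (?G v * exp (- (real m * v))))
      (1 / (real m + \<alpha>) - 1 / (real m + (1 - \<alpha>)))" for m
  proof -
    have "(\<lambda>v::real. indicator {0<..} v * (?G v * exp (- (real m * v)))) =
      (\<lambda>v. indicator {0<..} v * (v ^ 0 * exp (- ((real m + \<alpha>) * v))) -
          indicator {0<..} v * (v ^ 0 * exp (- ((real m + (1 - \<alpha>)) * v))))"
      by (auto simp: fun_eq_iff indicator_def left_diff_distrib exp_add[symmetric] algebra_simps)
    then show ?thesis using has_bochner_integral_diff[OF has_bochner_integral_power_exp[of "real m + \<alpha>" 0]
        has_bochner_integral_power_exp[of "real m + (1 - \<alpha>)" 0]] \<alpha>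
      by simp
  qed
  have "(\<lambda>m. 1 ^ m * (1 / (real m + \<alpha>) - 1 / (real m + (1 - \<alpha>)))) sums
      integral\<^sup>L lborel (\<lambda>v. indicator {0<..} v * (?G v / (1 - exp (- v))))"
    using geometric_integral_sums[of 1 ?G] int
    unfolding has_bochner_integral_integral_eq[OF hb] by simp
  with cot_sums[OF \<alpha>] have "integral\<^sup>L lborel (\<lambda>v. indicator {0<..} v * (?G v / (1 - exp (- v)))) = pi * cot (pi * \<alpha>)"
    by (auto simp: sums_unique2)
  with int show ?thesis by (simp add: has_bochner_integral_iff)
qed

section \<open>The kernels and their decay\<close>

definition mellin_kernel :: "real \<Rightarrow> nat \<Rightarrow> real \<Rightarrow> real \<Rightarrow> real" where
  "mellin_kernel b i \<alpha> z = z ^ i * exp (\<alpha> * z) / (1 - b * exp z)"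

lemma measurable_mellin_kernel [measurable]: "mellin_kernel b i \<alpha> \<in> borel_measurable borel"
  unfolding mellin_kernel_def [abs_def] by measurable

lemma one_minus_exp_nonzero:
  fixes b z :: real
  assumes "b \<in> {1, - 1}" "z \<noteq> 0"
  shows "1 - b * exp z \<noteq> 0"
proof (cases "b = 1")
  case False
  then have "1 - b * exp z = 1 + exp z" using assms by auto
  then show ?thesis using exp_gt_zero[of z] by linarith
qed (use assms in auto)

lemma exp_min_le:
  fixes z :: real
  assumes "0 \<le> t" "t \<le> 1"
  shows "min 1 (exp z) \<le> exp (t * z)"
proof (cases "z \<ge> 0")
  case True
  then have "1 \<le> exp (t * z)" using assms by simp
  then show ?thesis by (simp only: min.coboundedI1)
next
  case False
  then have "z \<le> t * z" using assms mult_right_mono_neg[of t 1 z] by simp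
  then show ?thesis by (intro min.coboundedI2) simp
qed

text \<open>The case \<open>mellin_kernel b 0 1\<close>. Unlike the Mellin kernels with
  \<open>0 < \<alpha> < 1\<close> it does not decay as \<open>z\<close> tends to infinity, where its
  limit is \<open>- b\<close>.\<close>

definition kern :: "real \<Rightarrow> real \<Rightarrow> real" where
  "kern b z = exp z / (1 - b * exp z)"

lemma measurable_kern [measurable]: "kern b \<in> borel_measurable borel"
  unfolding kern_def [abs_def] by measurable

text \<open>Since \<open>1 - b * exp z = - b * exp z * (1 - b * exp (- z))\<close>, the absolute
  value is \<open>min 1 (exp z) / (1 - b * exp (- \<bar>z\<bar>))\<close>. The minimum lies below
  \<open>exp (t * z)\<close> for all admissible \<open>t\<close>; this freedom later distributes the
  growth between \<open>u\<close> and \<open>v\<close>.\<close>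

lemma kern_bound:
  fixes b z t :: real
  assumes b: "b \<in> {1, - 1}" and z: "z \<noteq> 0" and t: "0 \<le> t" "t \<le> 1"
  shows "\<bar>kern b z\<bar> \<le> (1 + \<bar>z\<bar>) / \<bar>z\<bar> * exp (t * z)"
    and "b = - 1 \<Longrightarrow> \<bar>kern b z\<bar> \<le> exp (t * z)"
    and "0 < e \<Longrightarrow> e < \<bar>z\<bar> \<Longrightarrow> \<bar>kern b z\<bar> \<le> (1 + e) / e * exp (t * z)"
proof -
  have bb: "b * b = 1" "\<bar>b\<bar> = 1" using b by auto
  have eq: "\<bar>kern b z\<bar> = min 1 (exp z) * (1 / (1 - b * exp (- \<bar>z\<bar>)))"
  proof (cases "z > 0")
    case True
    have "exp z / (1 - b * exp z) = - b / (1 - b * exp (- z))"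
    proof -
      have "1 - b * exp z \<noteq> 0" "1 - b * exp (- z) \<noteq> 0"
        using one_minus_exp_nonzero[OF b] True by auto
      moreover have "exp z * (1 - b * exp (- z)) = - b * (1 - b * exp z)"
        using bb by (simp add: algebra_simps exp_add[symmetric])
      ultimately show ?thesis by (simp add: field_simps)
    qed
    then show ?thesis unfolding kern_def
      using one_minus_exp_bounds(1)[OF b True] True bb by (simp add: abs_mult)
  next
    case False
    then show ?thesis unfolding kern_def using one_minus_exp_bounds(1)[OF b, of "- z"] z by simp
  qed
  note bd = one_minus_exp_bounds[OF b, of "\<bar>z\<bar>"]
  have "\<bar>kern b z\<bar> \<le> exp (t * z) * ((1 + \<bar>z\<bar>) / \<bar>z\<bar>)"
    unfolding eq using bd(1,3) z exp_min_le[OF t, of z] by (intro mult_mono) auto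
  then show 1: "\<bar>kern b z\<bar> \<le> (1 + \<bar>z\<bar>) / \<bar>z\<bar> * exp (t * z)"
    by (simp add: mult.commute)
  show "\<bar>kern b z\<bar> \<le> exp (t * z)" if "b = - 1"
  proof -
    have "\<bar>kern b z\<bar> \<le> exp (t * z) * 1"
      unfolding eq using bd(1) bd(4)[OF _ that] z exp_min_le[OF t, of z] by (intro mult_mono) auto
    then show ?thesis by simp
  qed
  assume e: "0 < e" "e < \<bar>z\<bar>"
  have "(1 + \<bar>z\<bar>) / \<bar>z\<bar> * exp (t * z) \<le> (1 + e) / e * exp (t * z)"
    using e by (intro mult_right_mono) (auto simp: divide_simps algebra_simps)
  with 1 show "\<bar>kern b z\<bar> \<le> (1 + e) / e * exp (t * z)" by linarith
qed

lemma mellin_kernel_bound: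
  fixes b z :: real
  assumes b: "b \<in> {1, - 1}" and z: "z \<noteq> 0" and \<alpha>: "0 < \<alpha>" "\<alpha> < 1"
  shows "\<bar>mellin_kernel b i \<alpha> z\<bar> \<le> \<bar>z\<bar> ^ i * ((1 + \<bar>z\<bar>) / \<bar>z\<bar>) * exp (- (min \<alpha> (1 - \<alpha>) * \<bar>z\<bar>))"
    and "(b = 1 \<Longrightarrow> i \<noteq> 0) \<Longrightarrow>
        \<bar>mellin_kernel b i \<alpha> z\<bar> \<le> (1 + \<bar>z\<bar>) ^ i * exp (- (min \<alpha> (1 - \<alpha>) * \<bar>z\<bar>))"
proof -
  \<comment> \<open>The best rate on each side: up to powers, the Mellin kernel is
    \<open>exp ((\<alpha> - 1) * z)\<close> times \<open>kern\<close>, so it decays at rate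
    \<open>1 - \<alpha>\<close> to the right and \<open>\<alpha>\<close> to the left.\<close>
  define t :: real where "t = (if z > 0 then 0 else 1)"
  define K where "K = \<bar>kern b z\<bar>"
  have t: "0 \<le> t" "t \<le> 1" by (auto simp: t_def)
  have e: "exp ((\<alpha> - 1) * z) * exp (t * z) \<le> exp (- (min \<alpha> (1 - \<alpha>) * \<bar>z\<bar>))"
  proof (cases "z > 0")
    case True
    have "min \<alpha> (1 - \<alpha>) * z \<le> (1 - \<alpha>) * z"
      using True by (intro mult_right_mono) auto
    then show ?thesis using True by (simp add: t_def algebra_simps)
  next
    case False
    have "\<alpha> * z \<le> min \<alpha> (1 - \<alpha>) * z"
      using False by (intro mult_right_mono_neg) auto
    then show ?thesis using False by (simp add: t_def exp_add[symmetric] algebra_simps)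
  qed
  have eq: "\<bar>mellin_kernel b i \<alpha> z\<bar> = \<bar>z\<bar> ^ i * exp ((\<alpha> - 1) * z) * K"
    by (simp add: mellin_kernel_def K_def kern_def abs_mult power_abs exp_diff left_diff_distrib)
  have "\<bar>mellin_kernel b i \<alpha> z\<bar> \<le> \<bar>z\<bar> ^ i * exp ((\<alpha> - 1) * z) * ((1 + \<bar>z\<bar>) / \<bar>z\<bar> * exp (t * z))"
    unfolding eq using kern_bound(1)[OF b z t] by (intro mult_left_mono) (auto simp: K_def)
  also have "\<dots> = \<bar>z\<bar> ^ i * ((1 + \<bar>z\<bar>) / \<bar>z\<bar>) * (exp ((\<alpha> - 1) * z) * exp (t * z))"
    by simp
  also have "\<dots> \<le> \<bar>z\<bar> ^ i * ((1 + \<bar>z\<bar>) / \<bar>z\<bar>) * exp (- (min \<alpha> (1 - \<alpha>) * \<bar>z\<bar>))"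
    by (intro mult_left_mono e) auto
  finally show 1: "\<bar>mellin_kernel b i \<alpha> z\<bar> \<le> \<bar>z\<bar> ^ i * ((1 + \<bar>z\<bar>) / \<bar>z\<bar>) * exp (- (min \<alpha> (1 - \<alpha>) * \<bar>z\<bar>))" .
  show "\<bar>mellin_kernel b i \<alpha> z\<bar> \<le> (1 + \<bar>z\<bar>) ^ i * exp (- (min \<alpha> (1 - \<alpha>) * \<bar>z\<bar>))" if "b = 1 \<Longrightarrow> i \<noteq> 0"
  proof (cases i)
    case 0
    then have "K \<le> exp (t * z)" unfolding K_def using that b by (intro kern_bound(2)[OF b z t]) auto
    then have "exp ((\<alpha> - 1) * z) * K \<le> exp ((\<alpha> - 1) * z) * exp (t * z)"
      by (intro mult_left_mono) auto
    from order_trans[OF this e] show ?thesis using eq 0 by simp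
  next
    case (Suc j)
    have "\<bar>z\<bar> ^ i * ((1 + \<bar>z\<bar>) / \<bar>z\<bar>) = \<bar>z\<bar> ^ j * (1 + \<bar>z\<bar>)"
      using z Suc by simp
    also have "\<dots> \<le> (1 + \<bar>z\<bar>) ^ j * (1 + \<bar>z\<bar>)"
      by (intro mult_right_mono power_mono) auto
    also have "\<dots> = (1 + \<bar>z\<bar>) ^ i" using Suc by simp
    finally have "\<bar>z\<bar> ^ i * ((1 + \<bar>z\<bar>) / \<bar>z\<bar>) * exp (- (min \<alpha> (1 - \<alpha>) * \<bar>z\<bar>)) \<le> (1 + \<bar>z\<bar>) ^ i * exp (- (min \<alpha> (1 - \<alpha>) * \<bar>z\<bar>))"
      by (intro mult_right_mono) auto
    then show ?thesis using 1 by (rule order_trans[rotated])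
  qed
qed

lemma integrable_mellin_kernel:
  assumes b: "b \<in> {1, - 1}" and \<alpha>: "0 < \<alpha>" "\<alpha> < 1" and bi: "b = 1 \<Longrightarrow> i \<noteq> 0"
  shows "integrable lborel (mellin_kernel b i \<alpha>)"
proof (rule integrable_exp_dominated[where C = 1 and m = i and c = "min \<alpha> (1 - \<alpha>)"])
  fix u :: real
  assume u: "u \<noteq> 0"
  have "\<bar>mellin_kernel b i \<alpha> u\<bar> \<le> (1 + \<bar>u\<bar>) ^ i * 1 * exp (- (min \<alpha> (1 - \<alpha>) * \<bar>u\<bar>))"
    using mellin_kernel_bound(2)[OF b u \<alpha> bi] by simp
  also have "\<dots> \<le> (1 + \<bar>u\<bar>) ^ i * (1 + \<bar>u\<bar> powr - (1 / 2)) * exp (- (min \<alpha> (1 - \<alpha>) * \<bar>u\<bar>))"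
    by (intro mult_right_mono mult_left_mono) auto
  finally show "\<bar>mellin_kernel b i \<alpha> u\<bar>
     \<le> 1 * (1 + \<bar>u\<bar>) ^ i * (1 + \<bar>u\<bar> powr - (1 / 2)) * exp (- (min \<alpha> (1 - \<alpha>) * \<bar>u\<bar>))"
    by simp
qed (use \<alpha> in auto)

lemma integrable_mellin_kernel_cut:
  assumes b: "b \<in> {1, - 1}" and \<alpha>: "0 < \<alpha>" "\<alpha> < 1" and e: "e > 0"
  shows "integrable lborel (\<lambda>z. if e < \<bar>z\<bar> then mellin_kernel b i \<alpha> z else 0)"
proof (rule integrable_exp_dominated[where C = "(1 + e) / e" and m = i and c = "min \<alpha> (1 - \<alpha>)"])
  fix u :: real
  assume u: "u \<noteq> 0"
  show "\<bar>if e < \<bar>u\<bar> then mellin_kernel b i \<alpha> u else 0\<bar>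
     \<le> (1 + e) / e * (1 + \<bar>u\<bar>) ^ i * (1 + \<bar>u\<bar> powr - (1 / 2)) * exp (- (min \<alpha> (1 - \<alpha>) * \<bar>u\<bar>))"
  proof (cases "e < \<bar>u\<bar>")
    case True
    have "\<bar>mellin_kernel b i \<alpha> u\<bar> \<le> \<bar>u\<bar> ^ i * ((1 + \<bar>u\<bar>) / \<bar>u\<bar>) * exp (- (min \<alpha> (1 - \<alpha>) * \<bar>u\<bar>))"
      by (rule mellin_kernel_bound(1)[OF b u \<alpha>])
    also have "\<bar>u\<bar> ^ i * ((1 + \<bar>u\<bar>) / \<bar>u\<bar>) \<le> (1 + \<bar>u\<bar>) ^ i * ((1 + e) / e)"
      using True e by (intro mult_mono power_mono) (auto simp: divide_simps algebra_simps)
    also have "\<dots> = (1 + e) / e * (1 + \<bar>u\<bar>) ^ i * 1" by simp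
    also have "\<dots> \<le> (1 + e) / e * (1 + \<bar>u\<bar>) ^ i * (1 + \<bar>u\<bar> powr - (1 / 2))"
      using e by (intro mult_left_mono) auto
    finally show ?thesis using True by (simp add: mult_right_mono)
  qed (use e in auto)
qed (use \<alpha> in auto)

section \<open>Folding the line and the function \<Theta>\<close>

lemma has_bochner_integral_reflect:
  fixes f :: "real \<Rightarrow> real"
  assumes "has_bochner_integral lborel f x"
  shows "has_bochner_integral lborel (\<lambda>v. f (- v)) x"
  using lborel_has_bochner_integral_real_affine_iff[of "-1" f x 0] assms by simp

lemma integral_fold:
  fixes f :: "real \<Rightarrow> real"
  assumes f: "integrable lborel f"
  shows "has_bochner_integral lborel (\<lambda>v. indicator {0<..} v * (f v + f (- v))) (integral\<^sup>L lborel f)"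
proof -
  have f': "integrable lborel (\<lambda>v. f (- v))"
    using has_bochner_integral_reflect[of f] f by (auto simp: has_bochner_integral_iff)
  have [measurable]: "f \<in> borel_measurable borel" using f by auto
  have i1: "integrable lborel (\<lambda>v. indicator {0<..} v * f v)" if "integrable lborel f" for f :: "real \<Rightarrow> real"
    using integrable_real_mult_indicator[OF _ that, of "{0<..}"] by (simp add: mult.commute)
  have i2: "integrable lborel (\<lambda>v. indicator {..<0} v * f v)"
    using integrable_real_mult_indicator[OF _ f, of "{..<0}"] by (simp add: mult.commute)
  have r: "integral\<^sup>L lborel (\<lambda>v. indicator {0<..} v * f (- v)) = integral\<^sup>L lborel (\<lambda>v. indicator {..<0} v * f v)"
    using has_bochner_integral_reflect[OF has_bochner_integral_integrable[OF i2]]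
    by (simp add: has_bochner_integral_iff indicator_def)
  have "integral\<^sup>L lborel f = integral\<^sup>L lborel (\<lambda>v. indicator {0<..} v * f v + indicator {..<0} v * f v)"
  proof (rule integral_cong_AE)
    show "AE x in lborel. f x = indicator {0<..} x * f x + indicator {..<0} x * f x"
      using AE_lborel_singleton[of "0::real"] by eventually_elim (auto simp: indicator_def)
  qed auto
  also have "\<dots> = integral\<^sup>L lborel (\<lambda>v. indicator {0<..} v * f v) + integral\<^sup>L lborel (\<lambda>v. indicator {0<..} v * f (- v))"
    using i1[OF f] i2 r by simp
  finally show ?thesis
    using i1[OF f] i1[OF f'] by (simp add: has_bochner_integral_iff distrib_left)
qed

text \<open>Because \<open>b * b = 1\<close>, extracting \<open>- b * exp z\<close> from the
  denominator turns the value at \<open>z\<close> into one of the same type as that at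
  \<open>- z\<close>, with \<open>1 - \<alpha>\<close> in place of \<alpha>. The resulting signs are
  those of \<Theta>.\<close>

lemma mellin_kernel_fold:
  assumes b: "b \<in> {1, - 1}" and z: "z > 0"
  shows "mellin_kernel b i \<alpha> z + mellin_kernel b i \<alpha> (- z) =
    (- 1) ^ i * (z ^ i * exp (- (\<alpha> * z)) / (1 - b * exp (- z))
      + b * (- 1) ^ Suc i * (z ^ i * exp (- ((1 - \<alpha>) * z)) / (1 - b * exp (- z))))"
proof -
  have bb: "b * b = 1" using b by auto
  have nz: "1 - b * exp z \<noteq> 0" "1 - b * exp (- z) \<noteq> 0"
    using one_minus_exp_nonzero[OF b] z by auto
  have "exp (\<alpha> * z) * (1 - b * exp (- z)) = - b * exp (- ((1 - \<alpha>) * z)) * (1 - b * exp z)"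
    using bb by (simp add: algebra_simps exp_add[symmetric])
  then have "exp (\<alpha> * z) / (1 - b * exp z) = - b * exp (- ((1 - \<alpha>) * z)) / (1 - b * exp (- z))"
    using nz by (simp add: field_simps)
  then have "mellin_kernel b i \<alpha> z = - b * (z ^ i * exp (- ((1 - \<alpha>) * z)) / (1 - b * exp (- z)))"
    unfolding mellin_kernel_def by (metis (no_types, opaque_lifting) mult.assoc mult.left_commute times_divide_eq_right)
  moreover have "mellin_kernel b i \<alpha> (- z) = (- 1) ^ i * (z ^ i * exp (- (\<alpha> * z)) / (1 - b * exp (- z)))"
    by (simp add: mellin_kernel_def power_minus[of z])
  moreover have "(- 1) ^ i * (- 1) ^ i = (1 :: real)" by (simp flip: power_mult_distrib)
  ultimately show ?thesis by (simp add: algebra_simps)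
qed

text \<open>For \<open>b = 1\<close>, \<open>i = 0\<close> this is a principal value: the simple
  pole cancels between \<open>z\<close> and \<open>- z\<close>. In all other cases both summands are
  Lerch integrals.\<close>

lemma has_bochner_integral_theta:
  assumes b: "b \<in> {1, - 1}" and s: "0 < s" "s < r"
  shows "has_bochner_integral lborel
     (\<lambda>z. indicator {0<..} z * (mellin_kernel b i (s / r) z + mellin_kernel b i (s / r) (- z)))
     ((- 1) ^ i * fact i * lerch_theta b (Suc i) s r)"
proof -
  define \<alpha> where "\<alpha> = s / r"
  have \<alpha>: "0 < \<alpha>" "\<alpha> < 1" using s by (auto simp: \<alpha>_def)
  have \<alpha>': "(r - s) / r = 1 - \<alpha>" using s by (auto simp: \<alpha>_def field_simps)
  define f where "f = (\<lambda>\<alpha> z. indicator {0<..} z * (z ^ i * exp (- (\<alpha> * z)) / (1 - b * exp (- z))))"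
  have eq: "(\<lambda>z. indicator {0<..} z * (mellin_kernel b i \<alpha> z + mellin_kernel b i \<alpha> (- z))) =
     (\<lambda>z. (- 1) ^ i * (f \<alpha> z + b * (- 1) ^ Suc i * f (1 - \<alpha>) z))"
    using mellin_kernel_fold[OF b] by (auto simp: fun_eq_iff f_def indicator_def)
  have "has_bochner_integral lborel (\<lambda>z. (- 1) ^ i * (f \<alpha> z + b * (- 1) ^ Suc i * f (1 - \<alpha>) z))
      ((- 1) ^ i * (fact i * lerch_theta b (Suc i) s r))"
  proof (rule has_bochner_integral_mult_right)
    show "has_bochner_integral lborel (\<lambda>z. f \<alpha> z + b * (- 1) ^ Suc i * f (1 - \<alpha>) z) (fact i * lerch_theta b (Suc i) s r)"
    proof (cases "b = 1 \<and> i = 0")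
      case True
      have "(\<lambda>z. f \<alpha> z + b * (- 1) ^ Suc i * f (1 - \<alpha>) z) =
        (\<lambda>v. indicator {0<..} v * ((exp (- (\<alpha> * v)) - exp (- ((1 - \<alpha>) * v))) / (1 - exp (- v))))"
        using True by (auto simp: fun_eq_iff f_def indicator_def diff_divide_distrib)
      then show ?thesis
        using has_bochner_integral_cot[OF \<alpha>] True by (simp add: lerch_theta_def \<alpha>_def)
    next
      case False
      then have bi: "b = 1 \<Longrightarrow> i \<noteq> 0" by auto
      have f: "has_bochner_integral lborel (f x) (fact i * lerch_phi b (Suc i) x)" if "x > 0" for x
        unfolding f_def using has_bochner_integral_lerch[OF b bi that] .
      have "has_bochner_integral lborel (\<lambda>z. f \<alpha> z + b * (- 1) ^ Suc i * f (1 - \<alpha>) z)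
         (fact i * lerch_phi b (Suc i) \<alpha> + b * (- 1) ^ Suc i * (fact i * lerch_phi b (Suc i) (1 - \<alpha>)))"
        using \<alpha> by (intro has_bochner_integral_add has_bochner_integral_mult_right f) auto
      moreover have "lerch_theta b (Suc i) s r = lerch_phi b (Suc i) \<alpha> + b * (- 1) ^ Suc i * lerch_phi b (Suc i) (1 - \<alpha>)"
        unfolding lerch_theta_def \<alpha>' using False by (auto simp: \<alpha>_def)
      ultimately show ?thesis by (simp only: distrib_left mult.left_commute)
    qed
  qed
  then show ?thesis unfolding \<alpha>_def[symmetric] eq by (simp add: mult.assoc)
qed

lemma eventually_cut:
  fixes x :: real
  assumes "x \<noteq> 0"
  shows "eventually (\<lambda>m. 1 / real (Suc m) < \<bar>x\<bar>) sequentially"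
  using assms LIMSEQ_inverse_real_of_nat by (intro order_tendstoD(2)) (auto simp: inverse_eq_divide)

text \<open>\<phi> measures the distance to the singularity; it will be \<open>z\<close>,
  \<open>s - v\<close> or \<open>r * u - v\<close>. The cut-offs run through a sequence so that
  dominated convergence applies.\<close>

lemma integral_cut_tendsto:
  fixes F \<phi> :: "real \<Rightarrow> real"
  assumes F: "integrable lborel F" and [measurable]: "\<phi> \<in> borel_measurable borel"
    and nz: "AE z in lborel. \<phi> z \<noteq> 0"
  shows "(\<lambda>m. integral\<^sup>L lborel (\<lambda>z. if 1 / real (Suc m) < \<bar>\<phi> z\<bar> then F z else 0)) \<longlonglongrightarrow> integral\<^sup>L lborel F"
proof (rule integral_dominated_convergence[where w = "\<lambda>z. \<bar>F z\<bar>"])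
  show "AE z in lborel. (\<lambda>m. if 1 / real (Suc m) < \<bar>\<phi> z\<bar> then F z else 0) \<longlonglongrightarrow> F z"
    using nz
  proof eventually_elim
    case (elim z)
    from eventually_cut[OF elim] show ?case
      by (intro tendsto_eventually) (erule eventually_mono, simp)
  qed
  have [measurable]: "F \<in> borel_measurable borel" using F by auto
  show "(\<lambda>z. if 1 / real (Suc m) < \<bar>\<phi> z\<bar> then F z else 0) \<in> borel_measurable lborel" for m
    by measurable
qed (use F in auto)

text \<open>The cut is symmetric about 0, so folding is possible before the limit. The folded
  function is integrable even where the kernel is not, and its absolute value is the
  majorant.\<close>

lemma mellin_kernel_cut_tendsto:
  assumes b: "b \<in> {1, - 1}" and s: "0 < s" "s < r"
  shows "(\<lambda>m. integral\<^sup>L lborel (\<lambda>z. if 1 / real (Suc m) < \<bar>z\<bar> then mellin_kernel b i (s / r) z else 0))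
     \<longlonglongrightarrow> (- 1) ^ i * fact i * lerch_theta b (Suc i) s r"
proof -
  note theta = has_bochner_integral_theta[OF b s, of i]
  have eq: "integral\<^sup>L lborel (\<lambda>z. if 1 / real (Suc m) < \<bar>z\<bar> then mellin_kernel b i (s / r) z else 0) =
     integral\<^sup>L lborel (\<lambda>z. if 1 / real (Suc m) < \<bar>z\<bar> then
        indicator {0<..} z * (mellin_kernel b i (s / r) z + mellin_kernel b i (s / r) (- z)) else 0)" for m
  proof -
    let ?f = "\<lambda>z. if 1 / real (Suc m) < \<bar>z\<bar> then mellin_kernel b i (s / r) z else 0"
    have "integrable lborel ?f"
      using s by (intro integrable_mellin_kernel_cut[OF b]) auto
    from has_bochner_integral_integral_eq[OF integral_fold[OF this], symmetric]
    show ?thesis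
      by (rule trans) (auto intro!: Bochner_Integration.integral_cong)
  qed
  show ?thesis
    unfolding eq has_bochner_integral_integral_eq[OF theta, symmetric]
    using theta AE_lborel_singleton[of "0::real"]
    by (intro integral_cut_tendsto) (auto simp: has_bochner_integral_iff)
qed

lemma integral_mellin_kernel:
  assumes b: "b \<in> {1, - 1}" and s: "0 < s" "s < r" and bi: "b = 1 \<Longrightarrow> i \<noteq> 0"
  shows "has_bochner_integral lborel (mellin_kernel b i (s / r)) ((- 1) ^ i * fact i * lerch_theta b (Suc i) s r)"
proof -
  have "integrable lborel (mellin_kernel b i (s / r))"
    using s by (intro integrable_mellin_kernel[OF b _ _ bi]) auto
  with has_bochner_integral_eq[OF integral_fold[OF this] has_bochner_integral_theta[OF b s, of i]]
  show ?thesis by (simp add: has_bochner_integral_iff)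
qed

subsection \<open>The polylogarithm with a cut-off kernel\<close>

lemma kern_diff: "kern b (s - v) = exp s * exp (- v) / (1 - b * exp s * exp (- v))"
proof -
  have "exp (s - v) = exp s * exp (- v)" by (simp add: exp_add[symmetric])
  then show ?thesis by (simp add: kern_def mult.assoc)
qed

section \<open>From Lebesgue integrals to gauge integrals\<close>

lemma has_integral_change_of_variables:
  fixes F h h' :: "real \<Rightarrow> real"
  assumes S: "S \<in> sets lebesgue"
    and der: "\<And>u. u \<in> S \<Longrightarrow> (h has_field_derivative h' u) (at u within S)" and inj: "inj_on h S"
    and int: "has_bochner_integral lborel (\<lambda>u. indicator S u * (\<bar>h' u\<bar> * F (h u))) I"
  shows "(F has_integral I) (h ` S)"
proof -
  let ?f = "\<lambda>u. \<bar>h' u\<bar> * F (h u)"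
  have eq: "(\<lambda>u. indicator S u *\<^sub>R ?f u) = (\<lambda>u. indicator S u * ?f u)"
    by simp
  have int': "integrable lborel (\<lambda>u. indicator S u * ?f u)"
    and val: "integral\<^sup>L lborel (\<lambda>u. indicator S u * ?f u) = I"
    using int by (simp_all add: has_bochner_integral_iff)
  note m = borel_measurable_integrable[OF int']
  have si: "?f absolutely_integrable_on S"
    unfolding set_integrable_def eq using int' by (subst integrable_completion[OF m])
  have iv: "integral S ?f = I"
    unfolding set_lebesgue_integral_eq_integral(2)[OF si, symmetric] set_lebesgue_integral_def eq
    by (subst integral_completion[OF m]) (rule val)
  have "F absolutely_integrable_on h ` S \<and> integral (h ` S) F = I"
    using has_absolute_integral_change_of_variables_1'[OF S der inj, of F I] si iv by blast
  then show ?thesis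
    using set_lebesgue_integral_eq_integral(1) integrable_integral by metis
qed

lemma has_integral_exp_minus:
  fixes F :: "real \<Rightarrow> real"
  assumes "has_bochner_integral lborel (\<lambda>v. indicator {0<..} v * (F (exp (- v)) * exp (- v))) I"
  shows "(F has_integral I) {0..1}"
proof -
  have "(F has_integral I) ((\<lambda>v. exp (- v)) ` {0<..})"
  proof (rule has_integral_change_of_variables)
    show "((\<lambda>v. exp (- v)) has_field_derivative - exp (- u)) (at u within {0<..})" for u :: real
      by (auto intro!: derivative_eq_intros)
    show "has_bochner_integral lborel (\<lambda>v. indicator {0<..} v * (\<bar>- exp (- v)\<bar> * F (exp (- v)))) I"
      using assms by (simp add: mult.commute)
  qed (auto simp: inj_on_def)
  moreover have "(\<lambda>v::real. exp (- v)) ` {0<..} = {0<..<1}"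
  proof (intro equalityI subsetI)
    fix y :: real
    assume "y \<in> {0<..<1}"
    then have "y = exp (- (- ln y))" "- ln y \<in> {0<..}" by auto
    then show "y \<in> (\<lambda>v::real. exp (- v)) ` {0<..}" by (rule image_eqI)
  qed auto
  ultimately show ?thesis by (simp add: has_integral_Icc_iff_Ioo)
qed

text \<open>This is Li_1(x) = -ln(1 - x) at \<open>x = exp s\<close>. For \<open>s < 0\<close> the
  kernel is nonnegative on the half-line, so the fundamental theorem yields integrability together
  with the value.\<close>

lemma kern_one_antiderivative:
  fixes s :: real
  assumes s: "s < 0"
  shows "has_bochner_integral lborel (\<lambda>v. indicator {0<..} v * kern 1 (s - v)) (- ln (1 - exp s))"
proof -
  have lt: "exp (s - v) < 1" if "v \<ge> 0" for v using s that by simp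
  have nn: "kern 1 (s - v) \<ge> 0" if "v \<ge> 0" for v
    using lt[OF that] by (simp add: kern_def)
  have tend: "((\<lambda>v::real. ln (1 - exp (s - v))) \<longlongrightarrow> ln (1 - 0)) at_top"
  proof (intro tendsto_intros)
    have "filterlim (\<lambda>v. s - v) at_bot (at_top :: real filter)"
      by (subst filterlim_uminus_at_top[symmetric, where f = "\<lambda>v. v - s", simplified])
         (auto intro!: filterlim_tendsto_add_at_top[of "\<lambda>_. - s" "- s" _ "\<lambda>x. x", simplified] filterlim_ident)
    then show "((\<lambda>v. exp (s - v)) \<longlongrightarrow> 0) at_top"
      by (rule filterlim_compose[OF exp_at_bot])
  qed auto
  have "(\<integral>\<^sup>+v. ennreal (kern 1 (s - v)) * indicator {0..} v \<partial>lborel) = ln (1 - 0) - ln (1 - exp (s - 0))"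
  proof (rule nn_integral_FTC_atLeast[OF _ _ nn tend])
    show "((\<lambda>v. ln (1 - exp (s - v))) has_real_derivative kern 1 (s - x)) (at x)" if "0 \<le> x" for x
      using lt[OF that] by (auto intro!: derivative_eq_intros simp: kern_def field_simps)
  qed auto
  then have nn_int: "(\<integral>\<^sup>+v. ennreal (kern 1 (s - v)) * indicator {0..} v \<partial>lborel) = ennreal (- ln (1 - exp s))"
    by simp
  have "has_bochner_integral lborel (\<lambda>v. indicator {0..} v * kern 1 (s - v)) (- ln (1 - exp s))"
  proof (rule has_bochner_integral_nn_integral)
    have "(\<integral>\<^sup>+v. ennreal (indicator {0..} v * kern 1 (s - v)) \<partial>lborel) = (\<integral>\<^sup>+v. ennreal (kern 1 (s - v)) * indicator {0..} v \<partial>lborel)"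
      by (intro nn_integral_cong) (auto simp: indicator_def)
    then show "(\<integral>\<^sup>+v. ennreal (indicator {0..} v * kern 1 (s - v)) \<partial>lborel) = ennreal (- ln (1 - exp s))"
      using nn_int by simp
    show "AE v in lborel. 0 \<le> indicator {0..} v * kern 1 (s - v)"
      using nn by (auto simp: indicator_def)
    show "0 \<le> - ln (1 - exp s)" using s by (simp add: ln_le_zero_iff)
  qed auto
  then show ?thesis
  proof (rule has_bochner_integral_cong_AE[THEN iffD1, rotated 3])
    show "AE v in lborel. indicator {0..} v * kern 1 (s - v) = indicator {0<..} v * kern 1 (s - v)"
      using AE_lborel_singleton[of "0::real"] by eventually_elim (auto simp: indicator_def)
  qed auto
qed

text \<open>With \<open>x = exp s\<close> and \<open>y = exp (- v)\<close>, \<open>ln y ^ i\<close>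
  becomes \<open>(- 1) ^ i * v ^ i\<close>, whose sign cancels the one in \<open>polylog\<close>.
  The limit for \<open>e\<close> tending to 0 is therefore
  \<open>b * fact i * polylog (Suc i) (b * exp s)\<close> when \<open>s \<noteq> 0\<close>.\<close>

definition cut_polylog :: "real \<Rightarrow> nat \<Rightarrow> real \<Rightarrow> real \<Rightarrow> real" where
  "cut_polylog b i e s =
     integral\<^sup>L lborel (\<lambda>v. if e < \<bar>s - v\<bar> then indicator {0<..} v * (v ^ i * kern b (s - v)) else 0)"

lemma integrable_cut_polylog:
  assumes b: "b \<in> {1, - 1}" and e: "e > 0"
  shows "integrable lborel (\<lambda>v. if e < \<bar>s - v\<bar> then indicator {0<..} v * (v ^ i * kern b (s - v)) else 0)"
proof (rule integrable_exp_dominated[where C = "(1 + e) / e * exp s" and c = 1 and m = i])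
  fix v :: real
  show "\<bar>if e < \<bar>s - v\<bar> then indicator {0<..} v * (v ^ i * kern b (s - v)) else 0\<bar>
     \<le> (1 + e) / e * exp s * (1 + \<bar>v\<bar>) ^ i * (1 + \<bar>v\<bar> powr - (1 / 2)) * exp (- (1 * \<bar>v\<bar>))"
  proof (cases "e < \<bar>s - v\<bar> \<and> v > 0")
    case True
    have "\<bar>v ^ i * kern b (s - v)\<bar> \<le> (1 + v) ^ i * ((1 + e) / e * exp (1 * (s - v)))"
      unfolding abs_mult using kern_bound(3)[OF b _ _ _ e, of "s - v" 1] True e
      by (intro mult_mono) (auto simp: power_abs intro!: power_mono)
    also have "\<dots> = (1 + e) / e * exp s * (1 + \<bar>v\<bar>) ^ i * 1 * exp (- (1 * \<bar>v\<bar>))"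
      using True by (simp add: exp_diff exp_minus field_simps)
    also have "\<dots> \<le> (1 + e) / e * exp s * (1 + \<bar>v\<bar>) ^ i * (1 + \<bar>v\<bar> powr - (1 / 2)) * exp (- (1 * \<bar>v\<bar>))"
      using e by (intro mult_right_mono mult_left_mono) auto
    finally show ?thesis using True by simp
  qed (use e in auto)
qed auto

text \<open>The three cases tell how the removed interval \<open>[s - e, s + e]\<close> lies to the
  half-line \<open>v > 0\<close>: outside it, across its end point, or inside it. The explicit
  values make bounds uniform in \<open>e\<close> possible.\<close>

lemma cut_polylog_zero:
  fixes e s :: real
  assumes e: "e > 0"
  shows "cut_polylog 1 0 e s =
    (if s < - e then - ln (1 - exp s) else if s \<le> e then - ln (1 - exp (- e)) else e - ln (exp s - 1))"
proof -
  let ?f = "\<lambda>v. if e < \<bar>s - v\<bar> then indicator {0<..} v * (v ^ 0 * kern 1 (s - v)) else 0 :: real"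
  have tail: "has_bochner_integral lborel (\<lambda>v. indicator {s + e<..} v * kern 1 (s - v)) (- ln (1 - exp (- e)))"
  proof -
    have "has_bochner_integral lborel (\<lambda>v. indicator {0<..} (- (s + e) + 1 * v) * kern 1 (- e - (- (s + e) + 1 * v))) (- ln (1 - exp (- e)) /\<^sub>R \<bar>1\<bar>)"
      using kern_one_antiderivative[of "- e"] e
      by (subst lborel_has_bochner_integral_real_affine_iff[symmetric]) auto
    moreover have "(\<lambda>v. indicator {0<..} (- (s + e) + 1 * v) * kern 1 (- e - (- (s + e) + 1 * v))) = (\<lambda>v. indicator {s + e<..} v * kern 1 (s - v))"
      by (auto simp: fun_eq_iff indicator_def)
    ultimately show ?thesis by simp
  qed
  consider "s < - e" | "- e \<le> s" "s \<le> e" | "s > e" by linarith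
  then show ?thesis
  proof cases
    case 1
    then have "?f = (\<lambda>v. indicator {0<..} v * kern 1 (s - v))"
      using e by (auto simp: fun_eq_iff indicator_def)
    then show ?thesis
      unfolding cut_polylog_def using 1 e has_bochner_integral_integral_eq[OF kern_one_antiderivative[of s]] by simp
  next
    case 2
    then have "?f = (\<lambda>v. indicator {s + e<..} v * kern 1 (s - v))"
      using e by (auto simp: fun_eq_iff indicator_def)
    then show ?thesis
      unfolding cut_polylog_def using 2 e has_bochner_integral_integral_eq[OF tail] by simp
  next
    case 3
    have hd: "has_bochner_integral lborel (\<lambda>v. kern 1 (s - v) * indicator {0..s - e} v)
       (ln (exp (s - (s - e)) - 1) - ln (exp (s - 0) - 1))"
    proof (rule has_bochner_integral_FTC_Icc_real)
      fix x assume x: "0 \<le> x" "x \<le> s - e"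
      then have gt: "exp (s - x) > 1" using e by simp
      then show "((\<lambda>v. ln (exp (s - v) - 1)) has_real_derivative kern 1 (s - x)) (at x)"
        by (auto intro!: derivative_eq_intros simp: kern_def divide_simps algebra_simps)
      show "isCont (\<lambda>v. kern 1 (s - v)) x"
        using gt unfolding kern_def by (intro continuous_intros) auto
    qed (use 3 in simp)
    have "integral\<^sup>L lborel ?f = integral\<^sup>L lborel (\<lambda>v. kern 1 (s - v) * indicator {0..s - e} v + indicator {s + e<..} v * kern 1 (s - v))"
    proof (rule integral_cong_AE)
      show "AE v in lborel. ?f v = kern 1 (s - v) * indicator {0..s - e} v + indicator {s + e<..} v * kern 1 (s - v)"
        using AE_lborel_singleton[of "0::real"] AE_lborel_singleton[of "s - e"]
        by eventually_elim (use e 3 in \<open>auto simp: indicator_def\<close>)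
    qed auto
    also have "\<dots> = (ln (exp (s - (s - e)) - 1) - ln (exp (s - 0) - 1)) + (- ln (1 - exp (- e)))"
      by (rule has_bochner_integral_integral_eq[OF has_bochner_integral_add[OF hd tail]])
    \<comment> \<open>The two sides of the cut contribute logarithms that diverge as
      \<open>e\<close> tends to 0; their difference is exactly \<open>e\<close>.\<close>
    also have "ln (exp (s - (s - e)) - 1) = e + ln (1 - exp (- e))"
    proof -
      have "exp e - 1 = exp e * (1 - exp (- e))" by (simp add: algebra_simps exp_minus)
      then show ?thesis using e by (simp add: ln_mult)
    qed
    finally show ?thesis unfolding cut_polylog_def using 3 e by simp
  qed
qed

lemma ln_one_minus_exp_bound:
  fixes s :: real
  assumes s: "s \<noteq> 0"
  shows "\<bar>ln \<bar>1 - exp s\<bar>\<bar> \<le> \<bar>s\<bar> + 2 * \<bar>s\<bar> powr (- (1 / 2))"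
proof -
  have pos: "- ln (1 - exp (- t)) \<le> 2 * t powr (- (1 / 2)) \<and> - ln (1 - exp (- t)) \<ge> 0" if t: "t > 0" for t :: real
  proof -
    \<comment> \<open>The square root makes the logarithm harmless:
      \<open>1 / (1 - exp (- t)) \<le> 1 + x * x \<le> (1 + x) * (1 + x)\<close> and
      \<open>ln (1 + x) \<le> x\<close>.\<close>
    define x where "x = t powr (- (1 / 2))"
    have x: "x > 0" using t by (simp add: x_def)
    have xx: "x * x = 1 / t" unfolding x_def using t by (simp add: powr_add[symmetric] powr_minus_divide)
    have "exp (- t) < 1" using t by simp
    then have lt: "1 - exp (- t) > 0" by simp
    have "- ln (1 - exp (- t)) = ln (1 / (1 - exp (- t)))" using lt by (simp add: ln_div)
    also have "\<dots> \<le> ln ((1 + t) / t)"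
      using lt inverse_one_minus_exp_le[OF t] by (intro ln_mono) auto
    also have "(1 + t) / t = 1 + x * x" using t by (simp add: xx field_simps)
    also have "ln (1 + x * x) \<le> ln ((1 + x) * (1 + x))"
      using x by (intro ln_mono) (auto simp: algebra_simps add_pos_pos)
    also have "\<dots> = ln (1 + x) + ln (1 + x)" using x by (simp add: ln_mult)
    also have "\<dots> \<le> 2 * x" using ln_add_one_self_le_self[of x] x by simp
    finally show ?thesis using lt by (simp add: x_def ln_le_zero_iff)
  qed
  show ?thesis
  proof (cases "s < 0")
    case True
    then have "\<bar>1 - exp s\<bar> = 1 - exp (- \<bar>s\<bar>)" by simp
    then show ?thesis using pos[of "\<bar>s\<bar>"] True by (auto simp: abs_if)
  next
    case False
    then have s: "s > 0" using s by simp
    have e: "1 - exp (- s) > 0" using s by simp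
    have "\<bar>1 - exp s\<bar> = exp s * (1 - exp (- s))" using s by (simp add: algebra_simps exp_minus)
    then have "ln \<bar>1 - exp s\<bar> = s + ln (1 - exp (- s))" using e by (simp add: ln_mult)
    then show ?thesis using pos[OF s] s by linarith
  qed
qed

text \<open>In the range \<open>\<bar>s\<bar> \<le> e\<close> the value is frozen at
  \<open>- ln (1 - exp (- e))\<close>, which monotonicity of the logarithm bounds by the uncut value
  at \<open>s\<close>, up to \<open>e\<close>. Elsewhere it differs from the uncut value by at most
  \<open>e\<close>, and \<open>e \<le> 1\<close> removes the last dependence on
  \<open>e\<close>.\<close>

lemma cut_polylog_zero_bound:
  fixes e s :: real
  assumes e: "0 < e" "e \<le> 1" and s: "s \<noteq> 0"
  shows "\<bar>cut_polylog 1 0 e s\<bar> \<le> 2 * (1 + \<bar>s\<bar>) * (1 + \<bar>s\<bar> powr (- (1 / 2)))"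
proof -
  have "\<bar>cut_polylog 1 0 e s\<bar> \<le> 1 + \<bar>ln \<bar>1 - exp s\<bar>\<bar>"
  proof -
    consider "s < - e" | "- e \<le> s" "s < 0" | "0 < s" "s \<le> e" | "s > e" using s by linarith
    then show ?thesis
    proof cases
      case 1
      then show ?thesis using e by (simp add: cut_polylog_zero)
    next
      case 2
      have "exp s < 1" "exp (- e) < 1" using 2 e by simp_all
      moreover have "exp s \<ge> exp (- e)" using 2 by simp
      ultimately have "- ln (1 - exp (- e)) \<le> - ln (1 - exp s)" "ln (1 - exp (- e)) \<le> 0"
        by (simp_all add: ln_le_zero_iff)
      moreover have "cut_polylog 1 0 e s = - ln (1 - exp (- e))" "\<bar>1 - exp s\<bar> = 1 - exp s"
        using e 2 \<open>exp s < 1\<close> by (simp_all add: cut_polylog_zero)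
      ultimately show ?thesis by linarith
    next
      case 3
      have gt: "exp (- e) < 1" "exp s > 1" using 3 e by simp_all
      have "exp e - 1 = exp e * (1 - exp (- e))" by (simp add: algebra_simps exp_minus)
      then have "ln (exp e - 1) = e + ln (1 - exp (- e))" using gt by (simp add: ln_mult)
      moreover have "ln (exp s - 1) \<le> ln (exp e - 1)" using 3 gt by (intro ln_mono) auto
      moreover have "ln (1 - exp (- e)) \<le> 0" using gt by (simp add: ln_le_zero_iff)
      ultimately show ?thesis using e 3 gt by (simp add: cut_polylog_zero)
    next
      case 4
      then have "exp s > 1" using e by simp
      then show ?thesis using e 4 by (simp add: cut_polylog_zero)
    qed
  qed
  also have "\<dots> \<le> 1 + (\<bar>s\<bar> + 2 * \<bar>s\<bar> powr (- (1 / 2)))"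
    using ln_one_minus_exp_bound[OF s] by simp
  also have "\<dots> \<le> 2 * (1 + \<bar>s\<bar>) * (1 + \<bar>s\<bar> powr (- (1 / 2)))"
    by (simp add: algebra_simps)
  finally show ?thesis .
qed

lemma cut_polylog_zero_tendsto:
  fixes s :: real
  assumes s: "s \<noteq> 0"
  shows "(\<lambda>m. cut_polylog 1 0 (1 / real (Suc m)) s) \<longlonglongrightarrow> - ln \<bar>1 - exp s\<bar>"
proof -
  have lim: "(\<lambda>m. (if s < 0 then 0 else 1 / real (Suc m)) - ln \<bar>1 - exp s\<bar>) \<longlonglongrightarrow> 0 - ln \<bar>1 - exp s\<bar>"
    using LIMSEQ_inverse_real_of_nat
    by (cases "s < 0") (intro tendsto_diff tendsto_const; simp add: inverse_eq_divide)+
  have "eventually (\<lambda>m. cut_polylog 1 0 (1 / real (Suc m)) s = (if s < 0 then 0 else 1 / real (Suc m)) - ln \<bar>1 - exp s\<bar>) sequentially"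
    using eventually_cut[OF s]
  proof eventually_elim
    case (elim m)
    have e: "1 / real (Suc m) > 0" by simp
    show ?case
    proof (cases "s < 0")
      case True
      then have "s < - (1 / real (Suc m))" "exp s < 1" using elim by simp_all
      then show ?thesis using True by (subst cut_polylog_zero[OF e]) simp
    next
      case False
      then have "exp s > 1" "s > 1 / real (Suc m)" using elim s by simp_all
      moreover from this(2) have "\<not> s < - (1 / real (Suc m))" "\<not> s \<le> 1 / real (Suc m)"
        using e by linarith+
      ultimately show ?thesis using False by (subst cut_polylog_zero[OF e]) simp
    qed
  qed
  then show ?thesis using lim by (subst tendsto_cong) auto
qed

text \<open>Here the denominator does not vanish for \<open>v > 0\<close>, so the cut integrals
  approximate an absolutely convergent one and no principal value is involved.\<close>

lemma cut_polylog_tendsto_regular: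
  fixes s :: real
  assumes b: "b \<in> {1, - 1}" and s: "s \<noteq> 0" and bs: "b = - 1 \<or> s < 0"
  shows "(\<lambda>m. cut_polylog b i (1 / real (Suc m)) s) \<longlonglongrightarrow> b * fact i * polylog (Suc i) (b * exp s)"
proof -
  let ?F = "\<lambda>v. indicator {0<..} v * (v ^ i * kern b (s - v)) :: real"
  define C where "C = (if b = - 1 then 1 else (1 + \<bar>s\<bar>) / \<bar>s\<bar>)"
  have bd: "\<bar>kern b (s - v)\<bar> \<le> C * exp (s - v)" if v: "v > 0" for v
  proof (cases "b = - 1")
    case True
    then show ?thesis by (simp add: C_def kern_def divide_simps add_pos_pos)
  next
    case False
    then have neg: "s < 0" using bs by auto
    have "\<bar>kern b (s - v)\<bar> \<le> (1 + \<bar>s - v\<bar>) / \<bar>s - v\<bar> * exp (s - v)"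
      using kern_bound(1)[OF b, of "s - v" 1] v neg by simp
    \<comment> \<open>\<open>(1 + x) / x\<close> is decreasing, and
      \<open>\<bar>s - v\<bar> \<ge> \<bar>s\<bar>\<close> because \<open>s < 0 < v\<close>.\<close>
    also have "(1 + \<bar>s - v\<bar>) / \<bar>s - v\<bar> \<le> (1 + \<bar>s\<bar>) / \<bar>s\<bar>"
      using neg v by (simp add: field_simps)
    finally show ?thesis using False by (simp add: C_def mult_right_mono)
  qed
  have int: "integrable lborel ?F"
  proof (rule integrable_exp_dominated[where C = "C * exp s" and c = 1 and m = i])
    fix v :: real
    show "\<bar>?F v\<bar> \<le> C * exp s * (1 + \<bar>v\<bar>) ^ i * (1 + \<bar>v\<bar> powr - (1 / 2)) * exp (- (1 * \<bar>v\<bar>))"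
    proof (cases "v > 0")
      case True
      have C: "C \<ge> 0" by (simp add: C_def)
      have "\<bar>v ^ i * kern b (s - v)\<bar> \<le> (1 + v) ^ i * (C * exp (s - v))"
        unfolding abs_mult using bd[OF True] True
        by (intro mult_mono) (auto simp: power_abs intro!: power_mono)
      also have "\<dots> = C * exp s * (1 + \<bar>v\<bar>) ^ i * 1 * exp (- (1 * \<bar>v\<bar>))"
        using True by (simp add: exp_diff exp_minus field_simps)
      also have "\<dots> \<le> C * exp s * (1 + \<bar>v\<bar>) ^ i * (1 + \<bar>v\<bar> powr - (1 / 2)) * exp (- (1 * \<bar>v\<bar>))"
        using C by (intro mult_right_mono mult_left_mono) auto
      finally show ?thesis using True by simp
    qed (auto simp: C_def)
  qed auto
  have bb: "b * b = 1" using b by auto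
  have ii: "(- 1) ^ i * (- 1) ^ i = (1 :: real)" by (simp flip: power_mult_distrib)
  let ?G = "\<lambda>y. b * exp s * ln y ^ i / (1 - b * exp s * y)"
  have "(\<lambda>v. indicator {0<..} v * (?G (exp (- v)) * exp (- v))) = (\<lambda>v. b * (- 1) ^ i * ?F v)"
  proof
    fix v :: real
    have "(- v) ^ i = (- 1) ^ i * v ^ i" by (rule power_minus)
    then show "indicator {0<..} v * (?G (exp (- v)) * exp (- v)) = b * (- 1) ^ i * ?F v"
      unfolding kern_diff by (simp add: mult.assoc)
  qed
  then have "has_bochner_integral lborel (\<lambda>v. indicator {0<..} v * (?G (exp (- v)) * exp (- v))) (b * (- 1) ^ i * integral\<^sup>L lborel ?F)"
    using has_bochner_integral_mult_right[OF has_bochner_integral_integrable[OF int]] by simp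
  then have "integral {0..1} ?G = b * (- 1) ^ i * integral\<^sup>L lborel ?F"
    by (rule integral_unique[OF has_integral_exp_minus])
  moreover have "b * exp s \<le> 1" using bs
  proof
    assume "b = - 1"
    then have "b * exp s \<le> 0" by simp
    then show ?thesis by linarith
  qed (use b in \<open>auto intro: order_trans[of _ 0]\<close>)
  ultimately have "polylog (Suc i) (b * exp s) = (- 1) ^ i / fact i * (b * (- 1) ^ i * integral\<^sup>L lborel ?F)"
    by (simp add: polylog_def)
  then have "b * fact i * polylog (Suc i) (b * exp s) = (b * b) * ((- 1) ^ i * (- 1) ^ i) * integral\<^sup>L lborel ?F"
    by (simp add: field_simps)
  also have "\<dots> = integral\<^sup>L lborel ?F" by (simp only: bb ii mult_1_left)
  finally have eq: "b * fact i * polylog (Suc i) (b * exp s) = integral\<^sup>L lborel ?F" .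
  show ?thesis
    unfolding eq cut_polylog_def
    by (rule integral_cut_tendsto[OF int]) (use AE_lborel_singleton[of s] in auto)
qed

section \<open>Subtracting the pole\<close>

lemma power_diff_abs_le:
  fixes v s :: real
  shows "\<bar>v ^ i - s ^ i\<bar> \<le> \<bar>v - s\<bar> * (real i * ((1 + \<bar>v\<bar>) ^ i * (1 + \<bar>s\<bar>) ^ i))"
proof -
  have le: "\<bar>x ^ j\<bar> \<le> (1 + \<bar>x\<bar>) ^ i" if "j \<le> i" for x :: real and j
  proof -
    have "\<bar>x ^ j\<bar> \<le> (1 + \<bar>x\<bar>) ^ j" unfolding power_abs by (intro power_mono) auto
    also have "\<dots> \<le> (1 + \<bar>x\<bar>) ^ i" using that by (intro power_increasing) auto
    finally show ?thesis .
  qed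
  have "\<bar>\<Sum>j<i. s ^ (i - Suc j) * v ^ j\<bar> \<le> (\<Sum>j<i. (1 + \<bar>v\<bar>) ^ i * (1 + \<bar>s\<bar>) ^ i)"
  proof (rule order_trans[OF sum_abs sum_mono])
    fix j assume "j \<in> {..<i}"
    then have "\<bar>v ^ j\<bar> * \<bar>s ^ (i - Suc j)\<bar> \<le> (1 + \<bar>v\<bar>) ^ i * (1 + \<bar>s\<bar>) ^ i"
      by (intro mult_mono le) auto
    then show "\<bar>s ^ (i - Suc j) * v ^ j\<bar> \<le> (1 + \<bar>v\<bar>) ^ i * (1 + \<bar>s\<bar>) ^ i"
      by (simp add: abs_mult mult.commute)
  qed
  then have "\<bar>v - s\<bar> * \<bar>\<Sum>j<i. s ^ (i - Suc j) * v ^ j\<bar> \<le> \<bar>v - s\<bar> * (real i * ((1 + \<bar>v\<bar>) ^ i * (1 + \<bar>s\<bar>) ^ i))"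
    by (intro mult_left_mono) auto
  then show ?thesis
    by (subst power_diff_sumr2) (simp add: abs_mult)
qed

text \<open>The zero of \<open>v ^ i - s ^ i\<close> at \<open>v = s\<close> cancels the simple pole
  of the kernel, at the price of polynomial growth in both variables.\<close>

lemma subtracted_kernel_bound:
  fixes s t v :: real
  assumes t: "0 \<le> t" "t \<le> 1" and v: "v > 0"
  shows "\<bar>(v ^ i - s ^ i) * kern 1 (s - v)\<bar>
     \<le> real i * (1 + \<bar>s\<bar>) ^ Suc i * exp (t * s) * ((1 + v) ^ Suc i * exp (- (t * v)))"
proof (cases "s = v")
  case False
  let ?P = "real i * ((1 + v) ^ i * (1 + \<bar>s\<bar>) ^ i)"
  have "\<bar>(v ^ i - s ^ i) * kern 1 (s - v)\<bar> \<le> (\<bar>v - s\<bar> * ?P) * ((1 + \<bar>s - v\<bar>) / \<bar>s - v\<bar> * exp (t * (s - v)))"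
    unfolding abs_mult using power_diff_abs_le[of v i s] kern_bound(1)[of 1 "s - v" t] t v False
    by (intro mult_mono) auto
  also have "\<dots> = ?P * (1 + \<bar>s - v\<bar>) * exp (t * (s - v))"
    using False by (simp add: abs_minus_commute)
  also have "\<dots> \<le> ?P * ((1 + v) * (1 + \<bar>s\<bar>)) * exp (t * (s - v))"
  proof (intro mult_right_mono mult_left_mono)
    have "\<bar>s - v\<bar> \<le> \<bar>s\<bar> + v" "0 \<le> v * \<bar>s\<bar>" using v by auto
    then show "1 + \<bar>s - v\<bar> \<le> (1 + v) * (1 + \<bar>s\<bar>)" by (simp add: algebra_simps)
  qed (use v in auto)
  also have "\<dots> = real i * (1 + \<bar>s\<bar>) ^ Suc i * exp (t * s) * ((1 + v) ^ Suc i * exp (- (t * v)))"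
    by (simp add: right_diff_distrib exp_diff exp_minus field_simps)
  finally show ?thesis .
qed (use v in auto)

lemma integrable_subtracted_kernel:
  fixes s :: real
  shows "integrable lborel (\<lambda>v. indicator {0<..} v * ((v ^ i - s ^ i) * kern 1 (s - v)))"
proof (rule integrable_exp_dominated[where C = "real i * (1 + \<bar>s\<bar>) ^ Suc i * exp s" and c = 1 and m = "Suc i"])
  fix v :: real
  let ?C = "real i * (1 + \<bar>s\<bar>) ^ Suc i * exp s"
  show "\<bar>indicator {0<..} v * ((v ^ i - s ^ i) * kern 1 (s - v))\<bar>
     \<le> ?C * (1 + \<bar>v\<bar>) ^ Suc i * (1 + \<bar>v\<bar> powr - (1 / 2)) * exp (- (1 * \<bar>v\<bar>))"
  proof (cases "v > 0")
    case True
    have "\<bar>(v ^ i - s ^ i) * kern 1 (s - v)\<bar> \<le> ?C * (1 + \<bar>v\<bar>) ^ Suc i * 1 * exp (- (1 * \<bar>v\<bar>))"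
      using subtracted_kernel_bound[of 1 v i s] True by (simp add: mult.assoc)
    also have "\<dots> \<le> ?C * (1 + \<bar>v\<bar>) ^ Suc i * (1 + \<bar>v\<bar> powr - (1 / 2)) * exp (- (1 * \<bar>v\<bar>))"
      by (intro mult_right_mono mult_left_mono) auto
    finally show ?thesis using True by simp
  qed auto
qed auto

text \<open>Isolates the singularity: the integral has lost its pole, and the singular remainder no
  longer contains \<open>v ^ i\<close>, so that \<open>cut_polylog_zero\<close> evaluates
  it.\<close>

lemma cut_polylog_split:
  fixes s :: real
  assumes e: "e > 0"
  shows "cut_polylog 1 i e s =
     integral\<^sup>L lborel (\<lambda>v. if e < \<bar>s - v\<bar> then indicator {0<..} v * ((v ^ i - s ^ i) * kern 1 (s - v)) else 0)
     + s ^ i * cut_polylog 1 0 e s"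
proof -
  have 1: "integrable lborel (\<lambda>v. if e < \<bar>s - v\<bar> then indicator {0<..} v * (v ^ j * kern 1 (s - v)) else 0)" for j
    by (rule integrable_cut_polylog[OF _ e]) auto
  have "(\<lambda>v. if e < \<bar>s - v\<bar> then indicator {0<..} v * ((v ^ i - s ^ i) * kern 1 (s - v)) else 0) =
    (\<lambda>v. (if e < \<bar>s - v\<bar> then indicator {0<..} v * (v ^ i * kern 1 (s - v)) else 0)
       - s ^ i * (if e < \<bar>s - v\<bar> then indicator {0<..} v * (v ^ 0 * kern 1 (s - v)) else 0))"
    by (auto simp: fun_eq_iff algebra_simps)
  then show ?thesis
    unfolding cut_polylog_def using 1[of i] 1[of 0] by simp
qed

text \<open>\<open>polylog\<close> cuts out the pole \<open>1 / x\<close> symmetrically in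
  \<open>y\<close>, whereas \<open>cut_polylog\<close> cuts symmetrically in \<open>v\<close>. These
  excisions differ, so the two limits are compared through a common value: a regular integral minus
  an explicit logarithm.\<close>

lemma polylog_principal_value:
  fixes s :: real
  assumes s: "s > 0"
  shows "fact i * polylog (Suc i) (exp s) =
     integral\<^sup>L lborel (\<lambda>v. indicator {0<..} v * ((v ^ i - s ^ i) * kern 1 (s - v))) - s ^ i * ln (exp s - 1)"
proof -
  let ?D = "\<lambda>v. indicator {0<..} v * ((v ^ i - s ^ i) * kern 1 (s - v)) :: real"
  define x where "x = exp s"
  define c where "c = 1 / x"
  have x: "x > 1" using s by (simp add: x_def)
  have c: "0 < c" "c < 1" "x * c = 1" using x by (auto simp: c_def)
  define h where "h = (\<lambda>y. x * ln y ^ i / (1 - x * y))"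
  define h1 where "h1 = (\<lambda>y. x * (ln y ^ i - (- s) ^ i) / (1 - x * y))"
  define h2 where "h2 = (\<lambda>y. (- s) ^ i * (x / (1 - x * y)))"
  have h: "h = (\<lambda>y. h1 y + h2 y)"
    by (auto simp: fun_eq_iff h_def h1_def h2_def right_diff_distrib diff_divide_distrib)
  have ii: "(- 1) ^ i * (- 1) ^ i = (1 :: real)" by (simp flip: power_mult_distrib)
  have "(\<lambda>v. indicator {0<..} v * (h1 (exp (- v)) * exp (- v))) = (\<lambda>v. (- 1) ^ i * ?D v)"
  proof
    fix v :: real
    have "(- v) ^ i - (- s) ^ i = (- 1) ^ i * (v ^ i - s ^ i)"
      unfolding power_minus[of v] power_minus[of s] by (simp add: algebra_simps)
    then show "indicator {0<..} v * (h1 (exp (- v)) * exp (- v)) = (- 1) ^ i * ?D v"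
      unfolding kern_diff h1_def x_def by (simp add: mult.assoc)
  qed
  then have "has_bochner_integral lborel (\<lambda>v. indicator {0<..} v * (h1 (exp (- v)) * exp (- v))) ((- 1) ^ i * integral\<^sup>L lborel ?D)"
    using has_bochner_integral_mult_right[OF has_bochner_integral_integrable[OF integrable_subtracted_kernel]] by simp
  then have I1: "(h1 has_integral ((- 1) ^ i * integral\<^sup>L lborel ?D)) {0..1}"
    by (rule has_integral_exp_minus)
  then have int1: "h1 integrable_on {0..1}" by blast
  have sub: "h1 integrable_on {a..b}" if "0 \<le> a" "b \<le> 1" for a b
    using integrable_on_subinterval[OF int1, of a b] that by auto
  \<comment> \<open>The terms \<open>ln (x * e)\<close> from the two sides of the pole cancel,
    leaving only \<open>ln (x - 1)\<close>.\<close>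
  have pv: "integral {0..c - e} h + integral {c + e..1} h =
      integral {0..c - e} h1 + integral {c + e..1} h1 - (- s) ^ i * ln (x - 1)"
    if e: "0 < e" "e < c" "e < 1 - c" for e
  proof -
    have xe: "1 - x * (c - e) = x * e" "x * (c + e) - 1 = x * e"
      using c by (simp_all add: algebra_simps)
    have l: "(h2 has_integral ((- s) ^ i * (- ln (1 - x * (c - e)) - (- ln (1 - x * 0))))) {0..c - e}"
      unfolding h2_def
    proof (intro has_integral_mult_right fundamental_theorem_of_calculus)
      fix y assume y: "y \<in> {0..c - e}"
      then have "x * y \<le> x * (c - e)" using x by (intro mult_left_mono) auto
      also have "\<dots> < 1" using c x e by (simp add: algebra_simps)
      finally show "((\<lambda>y. - ln (1 - x * y)) has_vector_derivative x / (1 - x * y)) (at y within {0..c - e})"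
        by (auto intro!: derivative_eq_intros simp: has_real_derivative_iff_has_vector_derivative[symmetric])
    qed (use e in auto)
    have r: "(h2 has_integral ((- s) ^ i * (- ln (x * 1 - 1) - (- ln (x * (c + e) - 1))))) {c + e..1}"
      unfolding h2_def
    proof (intro has_integral_mult_right fundamental_theorem_of_calculus)
      fix y assume y: "y \<in> {c + e..1}"
      have "1 < x * (c + e)" using c x e by (simp add: algebra_simps)
      also have "\<dots> \<le> x * y" using x y by (intro mult_left_mono) auto
      finally show "((\<lambda>y. - ln (x * y - 1)) has_vector_derivative x / (1 - x * y)) (at y within {c + e..1})"
        by (auto intro!: derivative_eq_intros simp: has_real_derivative_iff_has_vector_derivative[symmetric] divide_simps algebra_simps)
    qed (use e in auto)
    have add: "integral {a..b} h = integral {a..b} h1 + integral {a..b} h2"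
      if "0 \<le> a" "b \<le> 1" "h2 integrable_on {a..b}" for a b
      unfolding h by (rule Henstock_Kurzweil_Integration.integral_add[OF sub]) (use that in auto)
    have "integral {0..c - e} h = integral {0..c - e} h1 + (- s) ^ i * (- ln (x * e))"
      using add[OF _ _ has_integral_integrable[OF l]] integral_unique[OF l] c e unfolding xe by simp
    moreover have "integral {c + e..1} h = integral {c + e..1} h1 + (- s) ^ i * (ln (x * e) - ln (x - 1))"
      using add[OF _ _ has_integral_integrable[OF r]] integral_unique[OF r] c e unfolding xe by simp
    ultimately show ?thesis by (simp add: algebra_simps)
  qed
  \<comment> \<open>\<open>h1\<close> is integrable across the pole, so closing the gap amounts to
    continuity of its indefinite integral.\<close>
  have cont: "isCont (\<lambda>t. integral {0..t} h1) c" "isCont (\<lambda>t. integral {t..1} h1) c"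
    using indefinite_integral_continuous_1[OF int1] indefinite_integral_continuous_1'[OF int1] c
    by (auto intro!: continuous_on_interior)
  have "((\<lambda>e. integral {0..c - e} h1 + integral {c + e..1} h1 - (- s) ^ i * ln (x - 1)) \<longlongrightarrow>
      integral {0..c} h1 + integral {c..1} h1 - (- s) ^ i * ln (x - 1)) (at_right 0)"
    by (intro tendsto_intros isCont_tendsto_compose[OF cont(1)] isCont_tendsto_compose[OF cont(2)])
       (auto intro!: tendsto_eq_intros)
  moreover have "integral {0..c} h1 + integral {c..1} h1 = (- 1) ^ i * integral\<^sup>L lborel ?D"
    using c integral_unique[OF I1] Henstock_Kurzweil_Integration.integral_combine[OF _ _ int1, of c] by simp
  moreover have "eventually (\<lambda>e. integral {0..c - e} h1 + integral {c + e..1} h1 - (- s) ^ i * ln (x - 1)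
       = integral {0..c - e} h + integral {c + e..1} h) (at_right 0)"
    using c by (auto intro!: eventually_at_rightI[of 0 "min c (1 - c)"] simp: pv)
  ultimately have "((\<lambda>e. integral {0..c - e} h + integral {c + e..1} h) \<longlongrightarrow>
      (- 1) ^ i * integral\<^sup>L lborel ?D - (- s) ^ i * ln (x - 1)) (at_right 0)"
    by (subst (asm) tendsto_cong) auto
  then have "cauchy_pv 0 c 1 h = (- 1) ^ i * integral\<^sup>L lborel ?D - (- s) ^ i * ln (x - 1)"
    unfolding cauchy_pv_def by (intro tendsto_Lim) auto
  then have "polylog (Suc i) x = (- 1) ^ i / fact i * ((- 1) ^ i * integral\<^sup>L lborel ?D - (- 1) ^ i * s ^ i * ln (x - 1))"
    using x by (simp add: polylog_def h_def c_def power_minus[of s])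
  then have "fact i * polylog (Suc i) x = ((- 1) ^ i * (- 1) ^ i) * (integral\<^sup>L lborel ?D - s ^ i * ln (x - 1))"
    by (simp add: field_simps)
  then show ?thesis by (simp only: ii mult_1_left x_def)
qed

lemma cut_polylog_tendsto:
  fixes s :: real
  assumes b: "b \<in> {1, - 1}" and s: "s \<noteq> 0"
  shows "(\<lambda>m. cut_polylog b i (1 / real (Suc m)) s) \<longlonglongrightarrow> b * fact i * polylog (Suc i) (b * exp s)"
proof (cases "b = - 1 \<or> s < 0")
  case False
  then have b1: "b = 1" and s: "s > 0" using b s by auto
  have "(\<lambda>m. cut_polylog 1 i (1 / real (Suc m)) s) \<longlonglongrightarrow>
      integral\<^sup>L lborel (\<lambda>v. indicator {0<..} v * ((v ^ i - s ^ i) * kern 1 (s - v))) + s ^ i * (- ln \<bar>1 - exp s\<bar>)"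
  proof -
    let ?D = "\<lambda>v. indicator {0<..} v * ((v ^ i - s ^ i) * kern 1 (s - v)) :: real"
    have split: "cut_polylog 1 i (1 / real (Suc m)) s =
        integral\<^sup>L lborel (\<lambda>v. if 1 / real (Suc m) < \<bar>s - v\<bar> then ?D v else 0) + s ^ i * cut_polylog 1 0 (1 / real (Suc m)) s" for m
      by (rule cut_polylog_split) simp
    have "(\<lambda>m. integral\<^sup>L lborel (\<lambda>v. if 1 / real (Suc m) < \<bar>s - v\<bar> then ?D v else 0)) \<longlonglongrightarrow> integral\<^sup>L lborel ?D"
      by (rule integral_cut_tendsto[OF integrable_subtracted_kernel]) (use AE_lborel_singleton[of s] in auto)
    moreover have "(\<lambda>m. s ^ i * cut_polylog 1 0 (1 / real (Suc m)) s) \<longlonglongrightarrow> s ^ i * (- ln \<bar>1 - exp s\<bar>)"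
      using s by (intro tendsto_mult_left cut_polylog_zero_tendsto) simp
    ultimately show ?thesis
      unfolding split by (rule tendsto_add)
  qed
  also have "\<bar>1 - exp s\<bar> = exp s - 1" using s by simp
  finally show ?thesis using polylog_principal_value[OF s, of i] b1 by simp
qed (use cut_polylog_tendsto_regular[OF b s] in auto)

text \<open>\<open>C\<close> depends neither on \<open>e\<close> nor on \<open>s\<close>, the
  singularity at \<open>s = 0\<close> is integrable, and the rate \<open>t\<close> may be taken
  small. For \<open>b = - 1\<close> the kernel is bounded directly; for \<open>b = 1\<close> the
  pole is split off first.\<close>

lemma cut_polylog_bound:
  fixes t :: real
  assumes b: "b \<in> {1, - 1}" and t: "0 < t" "t \<le> 1"
  obtains C where "\<And>e s. 0 < e \<Longrightarrow> e \<le> 1 \<Longrightarrow> s \<noteq> 0 \<Longrightarrow>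
    \<bar>cut_polylog b i e s\<bar> \<le> C * (1 + \<bar>s\<bar>) ^ Suc i * (1 + \<bar>s\<bar> powr (- (1 / 2))) * exp (t * \<bar>s\<bar>)"
proof -
  define g where "g = (\<lambda>v. indicator {0<..} v * ((1 + v) ^ Suc i * exp (- (t * v))) :: real)"
  have g: "integrable lborel g"
  proof (rule integrable_exp_dominated[OF _ t(1), where C = 1 and m = "Suc i"])
    fix v :: real
    show "\<bar>g v\<bar> \<le> 1 * (1 + \<bar>v\<bar>) ^ Suc i * (1 + \<bar>v\<bar> powr - (1 / 2)) * exp (- (t * \<bar>v\<bar>))"
    proof (cases "v > 0")
      case True
      then have "\<bar>g v\<bar> = 1 * (1 + \<bar>v\<bar>) ^ Suc i * 1 * exp (- (t * \<bar>v\<bar>))"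
        by (simp add: g_def abs_mult)
      also have "\<dots> \<le> 1 * (1 + \<bar>v\<bar>) ^ Suc i * (1 + \<bar>v\<bar> powr - (1 / 2)) * exp (- (t * \<bar>v\<bar>))"
        by (intro mult_right_mono mult_left_mono) auto
      finally show ?thesis .
    qed (auto simp: g_def)
  qed (auto simp: g_def)
  define J where "J = integral\<^sup>L lborel g"
  have J: "J \<ge> 0" unfolding J_def by (intro integral_nonneg_AE AE_I2) (auto simp: g_def indicator_def)
  have bound: "\<bar>integral\<^sup>L lborel f\<bar> \<le> A * J"
    if f: "integrable lborel f" and le: "\<And>v. \<bar>f v\<bar> \<le> A * g v" for f :: "real \<Rightarrow> real" and A
    unfolding J_def
    using Bochner_Integration.integral_norm_bound_integral[OF f integrable_mult_right[OF g, of A]] le g by simp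
  show ?thesis
  proof (rule that)
    fix e s :: real
    assume e: "0 < e" "e \<le> 1" and s: "s \<noteq> 0"
    let ?p = "1 + \<bar>s\<bar> powr (- (1 / 2))"
    let ?E = "exp (t * \<bar>s\<bar>)"
    have ts: "exp (t * s) \<le> ?E" using t by (simp add: mult_left_mono)
    have E1: "1 \<le> ?E" using t by simp
    have p1: "1 \<le> ?p" by simp
    have s1: "1 \<le> (1 + \<bar>s\<bar>) ^ Suc i" by (intro one_le_power) auto
    show "\<bar>cut_polylog b i e s\<bar> \<le> ((real i + 1) * J + 2) * (1 + \<bar>s\<bar>) ^ Suc i * ?p * ?E"
    proof (cases "b = 1")
      case False
      then have b1: "b = - 1" using b by auto
      have "\<bar>cut_polylog b i e s\<bar> \<le> exp (t * s) * J"
        unfolding cut_polylog_def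
      proof (rule bound[OF integrable_cut_polylog[OF b e(1)]])
        fix v :: real
        show "\<bar>if e < \<bar>s - v\<bar> then indicator {0<..} v * (v ^ i * kern b (s - v)) else 0\<bar> \<le> exp (t * s) * g v"
        proof (cases "v > 0 \<and> e < \<bar>s - v\<bar>")
          case True
          have "v ^ i \<le> (1 + v) ^ i" using True by (intro power_mono) auto
          also have "\<dots> \<le> (1 + v) ^ Suc i" using True by (intro power_increasing) auto
          finally have vi: "v ^ i \<le> (1 + v) ^ Suc i" .
          have "\<bar>v ^ i * kern b (s - v)\<bar> \<le> (1 + v) ^ Suc i * exp (t * (s - v))"
            unfolding abs_mult using kern_bound(2)[OF b _ _ _ b1, of "s - v" t] True e t vi
            by (intro mult_mono) auto
          also have "\<dots> = exp (t * s) * g v"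
            using True by (simp add: g_def right_diff_distrib exp_diff exp_minus field_simps)
          finally show ?thesis using True by simp
        qed (auto simp: g_def indicator_def)
      qed
      also have "\<dots> \<le> (1 * 1 * ?E) * ((real i + 1) * J + 2)"
        using ts J by (intro mult_mono) (auto simp: algebra_simps)
      also have "\<dots> \<le> ((1 + \<bar>s\<bar>) ^ Suc i * ?p * ?E) * ((real i + 1) * J + 2)"
        using J s1 p1 by (intro mult_right_mono mult_mono) auto
      finally show ?thesis by (simp add: mult_ac)
    next
      case True
      let ?D = "\<lambda>v. indicator {0<..} v * ((v ^ i - s ^ i) * kern 1 (s - v)) :: real"
      let ?f = "\<lambda>v. if e < \<bar>s - v\<bar> then ?D v else 0"
      define A where "A = real i * (1 + \<bar>s\<bar>) ^ Suc i * exp (t * s)"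
      have A: "A \<ge> 0" by (simp add: A_def)
      have D: "\<bar>?D v\<bar> \<le> A * g v" for v
        using subtracted_kernel_bound[of t v i s] t by (cases "v > 0") (simp_all add: g_def A_def)
      have gn: "0 \<le> A * g v" for v using A by (auto simp: g_def indicator_def)
      have "\<bar>integral\<^sup>L lborel ?f\<bar> \<le> A * J"
      proof (rule bound)
        show "integrable lborel ?f"
          by (rule Bochner_Integration.integrable_bound[OF integrable_subtracted_kernel[of i s]]) auto
        show "\<bar>?f v\<bar> \<le> A * g v" for v using D[of v] gn[of v] by simp
      qed
      also have "A * J \<le> real i * (1 + \<bar>s\<bar>) ^ Suc i * ?E * J"
        unfolding A_def using ts J by (intro mult_right_mono mult_left_mono) auto
      also have "\<dots> = (real i * J) * ((1 + \<bar>s\<bar>) ^ Suc i * 1 * ?E)" by simp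
      also have "\<dots> \<le> ((real i + 1) * J) * ((1 + \<bar>s\<bar>) ^ Suc i * ?p * ?E)"
        using J by (intro mult_mono mult_right_mono mult_left_mono) auto
      finally have 1: "\<bar>integral\<^sup>L lborel ?f\<bar> \<le> ((real i + 1) * J) * ((1 + \<bar>s\<bar>) ^ Suc i * ?p * ?E)" .
      have "\<bar>s ^ i * cut_polylog 1 0 e s\<bar> \<le> (1 + \<bar>s\<bar>) ^ i * (2 * (1 + \<bar>s\<bar>) * ?p)"
        unfolding abs_mult power_abs
        using cut_polylog_zero_bound[OF e s] by (intro mult_mono power_mono) auto
      also have "\<dots> = 2 * ((1 + \<bar>s\<bar>) ^ Suc i * ?p * 1)" by simp
      also have "\<dots> \<le> 2 * ((1 + \<bar>s\<bar>) ^ Suc i * ?p * ?E)"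
        using E1 by (intro mult_left_mono) auto
      finally have 2: "\<bar>s ^ i * cut_polylog 1 0 e s\<bar> \<le> 2 * ((1 + \<bar>s\<bar>) ^ Suc i * ?p * ?E)" .
      have "\<bar>cut_polylog b i e s\<bar> \<le> \<bar>integral\<^sup>L lborel ?f\<bar> + \<bar>s ^ i * cut_polylog 1 0 e s\<bar>"
        using abs_triangle_ineq[of "integral\<^sup>L lborel ?f"] cut_polylog_split[OF e(1), of i s]
        by (simp only: True)
      also have "\<dots> \<le> ((real i + 1) * J) * ((1 + \<bar>s\<bar>) ^ Suc i * ?p * ?E) + 2 * ((1 + \<bar>s\<bar>) ^ Suc i * ?p * ?E)"
        using 1 2 by linarith
      also have "\<dots> = ((real i + 1) * J + 2) * (1 + \<bar>s\<bar>) ^ Suc i * ?p * ?E"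
        by (simp only: distrib_right mult.assoc)
      finally show ?thesis .
    qed
  qed
qed

subsection \<open>The double integral\<close>

text \<open>The geometric sum gives \<open>d * S = 1 - A * Z\<close>. Together with
  \<open>A * A = 1\<close> this yields \<open>D - d * S = A * Z * E\<close>, where \<open>E\<close>
  is free of \<open>X\<close>; dividing by \<open>d * D * E\<close> separates the two
  denominators.\<close>

lemma partial_fraction:
  fixes a b X y :: real
  assumes aa: "a * a = 1" and nz: "1 - a * X\<^sup>2 \<noteq> 0" "1 - b * y * X ^ (2 * n) \<noteq> 0" "1 - a ^ n * b * y \<noteq> 0"
  shows "b * X ^ (2 * n) / ((1 - a * X\<^sup>2) * (1 - b * y * X ^ (2 * n)))
    = a ^ n * b / (1 - a ^ n * b * y) * (1 / (1 - a * X\<^sup>2) - (\<Sum>j<n. a ^ j * X ^ (2 * j)) / (1 - b * y * X ^ (2 * n)))"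
proof -
  define S where "S = (\<Sum>j<n. a ^ j * X ^ (2 * j))"
  define Z where "Z = X ^ (2 * n)"
  define d where "d = 1 - a * X\<^sup>2"
  define A where "A = a ^ n"
  have A: "A * A = 1" using aa by (simp add: A_def flip: power_mult_distrib)
  have "d * S = 1 - (a * X\<^sup>2) ^ n"
    unfolding d_def S_def one_diff_power_eq by (simp add: power_mult_distrib power_mult)
  also have "\<dots> = 1 - A * Z" by (simp add: A_def Z_def power_mult_distrib power_mult)
  finally have dS: "d * S = 1 - A * Z" .
  define D where "D = 1 - b * y * Z"
  define E where "E = 1 - A * b * y"
  have nz': "d \<noteq> 0" "D \<noteq> 0" "E \<noteq> 0"
    using nz by (simp_all add: Z_def d_def A_def D_def E_def)
  have key: "b * Z * E = A * b * (D - d * S)"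
    unfolding dS D_def E_def using A by (simp add: algebra_simps)
  have "b * Z / (d * D) = b * Z * E / (E * (d * D))" using nz' by simp
  also have "\<dots> = A * b / E * (1 / d - S / D)"
    unfolding key using nz' by (simp add: field_simps)
  finally have "b * Z / (d * D) = A * b / E * (1 / d - S / D)" .
  then show ?thesis by (simp only: S_def Z_def d_def A_def D_def E_def)
qed

locale polylog_integral =
  fixes a b :: real and i l n :: nat
  assumes a: "a \<in> {1, - 1}" and b: "b \<in> {1, - 1}" and n: "n \<ge> 1"
    and ci: "a ^ n * b = 1 \<Longrightarrow> i \<noteq> 0" and al: "a = 1 \<Longrightarrow> l \<noteq> 0"
begin

definition r :: real where "r = 2 * real n"

definition c :: real where "c = a ^ n * b"

definition g :: "real \<Rightarrow> real" where
  "g u = u ^ l * exp u / (1 - a * exp (2 * u))"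

lemma r_pos: "r > 0" using n by (simp add: r_def)

lemma c: "c \<in> {1, - 1}"
proof -
  have "a ^ n = 1 \<or> a ^ n = - 1" using a power2_eq_1_iff[of "a ^ n"] by (auto simp: power_mult[symmetric])
  then show ?thesis using b by (auto simp: c_def)
qed

text \<open>In the variable \<open>2 * u\<close>, \<open>g\<close> is a Mellin kernel with
  \<open>\<alpha> = 1 / 2\<close>, the source of \<Phi>(a, q, 1/2). The summand 0 gives the argument
  the form of an affine substitution.\<close>

lemma g_eq: "g u = mellin_kernel a l (1 / 2) (0 + 2 * u) / 2 ^ l"
  by (simp add: g_def mellin_kernel_def power_mult_distrib)

lemma measurable_g [measurable]: "g \<in> borel_measurable borel"
  unfolding g_def [abs_def] by measurable

lemma g_bound:
  assumes u: "u \<noteq> 0"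
  shows "\<bar>g u\<bar> \<le> (1 + \<bar>u\<bar>) ^ l * exp (- \<bar>u\<bar>)"
proof -
  have "\<bar>mellin_kernel a l (1 / 2) (2 * u)\<bar> \<le> (1 + \<bar>2 * u\<bar>) ^ l * exp (- \<bar>u\<bar>)"
    using mellin_kernel_bound(2)[OF a, of "2 * u" "1 / 2" l] u al by (simp add: abs_mult)
  then have "\<bar>g u\<bar> \<le> ((1 + \<bar>2 * u\<bar>) ^ l * exp (- \<bar>u\<bar>)) / 2 ^ l"
    unfolding g_eq abs_divide by (simp add: divide_right_mono)
  also have "\<dots> \<le> ((2 * (1 + \<bar>u\<bar>)) ^ l * exp (- \<bar>u\<bar>)) / 2 ^ l"
    by (intro divide_right_mono mult_right_mono power_mono) auto
  also have "\<dots> = (1 + \<bar>u\<bar>) ^ l * exp (- \<bar>u\<bar>)" unfolding power_mult_distrib by simp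
  finally show ?thesis .
qed

lemma has_bochner_integral_g:
  "has_bochner_integral lborel g ((- 1) ^ l * fact l * lerch_theta a (Suc l) 1 2 / 2 ^ Suc l)"
proof -
  have "has_bochner_integral lborel (mellin_kernel a l (1 / 2)) ((- 1) ^ l * fact l * lerch_theta a (Suc l) 1 2)"
    by (rule integral_mellin_kernel[OF a _ _ al]) auto
  from has_bochner_integral_divide[OF lborel_has_bochner_integral_real_affine_iff[THEN iffD1, OF _ this, of 2 0], of "2 ^ l"]
  show ?thesis unfolding g_eq [abs_def] by (simp add: field_simps)
qed

lemma integrable_g: "integrable lborel g"
  using has_bochner_integral_g by (simp add: has_bochner_integral_iff)

subsection \<open>Exchanging the integrals\<close>

definition H :: "real \<Rightarrow> real \<Rightarrow> real \<Rightarrow> real" where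
  "H e u v = g u * (if e < \<bar>r * u - v\<bar> then indicator {0<..} v * (v ^ i * kern b (r * u - v)) else 0)"

text \<open>Off the strip the kernel lies below a multiple of \<open>exp (t * (r * u - v))\<close>,
  which factors; the majorant is thus a product of a function of \<open>u\<close> and a function of
  \<open>v\<close>.\<close>

lemma integrable_H:
  assumes e: "e > 0"
  shows "integrable (lborel \<Otimes>\<^sub>M lborel) (\<lambda>(u, v). H e u v)"
proof -
  \<comment> \<open>Makes \<open>t * r = 1 / 2\<close>, so that the growth
    \<open>exp (u / 2)\<close> is absorbed by half of the decay of \<open>g\<close>.\<close>
  define t where "t = 1 / (2 * r)"
  have t: "0 < t" "t \<le> 1" using n by (auto simp: t_def r_def)
  define \<phi> where "\<phi> = (\<lambda>u. g u * exp (u / 2))"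
  define \<psi> where "\<psi> = (\<lambda>v. indicator {0<..} v * (v ^ i * exp (- (t * v))) :: real)"
  have [measurable]: "\<phi> \<in> borel_measurable borel" "\<psi> \<in> borel_measurable borel"
    unfolding \<phi>_def \<psi>_def by measurable
  have \<phi>: "integrable lborel \<phi>"
  proof (rule integrable_exp_dominated[where C = 1 and m = l and c = "1 / 2"])
    fix u :: real
    assume u: "u \<noteq> 0"
    have "\<bar>\<phi> u\<bar> \<le> (1 + \<bar>u\<bar>) ^ l * exp (- \<bar>u\<bar>) * exp (\<bar>u\<bar> / 2)"
      unfolding \<phi>_def abs_mult using g_bound[OF u] by (intro mult_mono) auto
    also have "\<dots> = (1 + \<bar>u\<bar>) ^ l * 1 * exp (- (1 / 2 * \<bar>u\<bar>))"
      by (simp add: exp_add[symmetric] mult.assoc)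
    also have "\<dots> \<le> (1 + \<bar>u\<bar>) ^ l * (1 + \<bar>u\<bar> powr - (1 / 2)) * exp (- (1 / 2 * \<bar>u\<bar>))"
      by (intro mult_right_mono mult_left_mono) auto
    finally show "\<bar>\<phi> u\<bar> \<le> 1 * (1 + \<bar>u\<bar>) ^ l * (1 + \<bar>u\<bar> powr - (1 / 2)) * exp (- (1 / 2 * \<bar>u\<bar>))"
      by simp
  qed auto
  have \<psi>: "integrable lborel \<psi>"
    unfolding \<psi>_def using has_bochner_integral_power_exp[OF t(1), of i] by (simp add: has_bochner_integral_iff)
  have prod: "integrable (lborel \<Otimes>\<^sub>M lborel) (\<lambda>(u, v). (1 + e) / e * (\<phi> u * \<psi> v))"
  proof (rule lborel_pair.Fubini_integrable)
    show "integrable lborel (\<lambda>u. LBINT v. norm (case (u, v) of (u, v) \<Rightarrow> (1 + e) / e * (\<phi> u * \<psi> v)))"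
      using \<phi> \<psi> by (simp add: abs_mult)
    show "AE u in lborel. integrable lborel (\<lambda>v. case (u, v) of (u, v) \<Rightarrow> (1 + e) / e * (\<phi> u * \<psi> v))"
      using \<psi> by simp
  qed measurable
  show ?thesis
  proof (rule Bochner_Integration.integrable_bound[OF prod])
    have "\<bar>H e u v\<bar> \<le> \<bar>(1 + e) / e * (\<phi> u * \<psi> v)\<bar>" for u v
    proof (cases "e < \<bar>r * u - v\<bar> \<and> v > 0")
      case True
      have "\<bar>kern b (r * u - v)\<bar> \<le> (1 + e) / e * exp (t * (r * u - v))"
        using kern_bound(3)[OF b _ _ _ e, of "r * u - v" t] True t e by auto
      also have "t * (r * u - v) = u / 2 + - (t * v)"
        using r_pos by (simp add: t_def field_simps)
      finally have "\<bar>kern b (r * u - v)\<bar> \<le> (1 + e) / e * (exp (u / 2) * exp (- (t * v)))"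
        by (simp only: exp_add)
      then have "\<bar>g u\<bar> * (v ^ i * \<bar>kern b (r * u - v)\<bar>) \<le> \<bar>g u\<bar> * (v ^ i * ((1 + e) / e * (exp (u / 2) * exp (- (t * v)))))"
        using True by (intro mult_left_mono) auto
      also have "\<dots> = (1 + e) / e * (\<bar>\<phi> u\<bar> * \<bar>\<psi> v\<bar>)"
        using True by (simp add: \<phi>_def \<psi>_def abs_mult)
      finally show ?thesis
        using True e by (simp add: H_def abs_mult power_abs)
    qed (auto simp: H_def)
    then show "AE x in lborel \<Otimes>\<^sub>M lborel. norm (case x of (u, v) \<Rightarrow> H e u v)
        \<le> norm (case x of (u, v) \<Rightarrow> (1 + e) / e * (\<phi> u * \<psi> v))"
      by (auto split: prod.split)
  qed (unfold H_def, measurable)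
qed

lemma H_fubini:
  assumes e: "e > 0"
  shows "integral\<^sup>L lborel (\<lambda>u. g u * cut_polylog b i e (r * u)) = integral\<^sup>L lborel (\<lambda>v. integral\<^sup>L lborel (\<lambda>u. H e u v))"
proof -
  have "integral\<^sup>L lborel (\<lambda>u. g u * cut_polylog b i e (r * u)) = integral\<^sup>L lborel (\<lambda>u. integral\<^sup>L lborel (\<lambda>v. H e u v))"
    unfolding H_def cut_polylog_def by simp
  also have "\<dots> = integral\<^sup>L lborel (\<lambda>v. integral\<^sup>L lborel (\<lambda>u. H e u v))"
    by (rule lborel_pair.Fubini_integral[OF integrable_H[OF e], symmetric])
  finally show ?thesis .
qed

subsection \<open>The inner integral\<close>

text \<open>Here \<open>j\<close> starts at 0, so \<open>2 * real j + 1\<close> is the 2j - 1 of the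
  theorem.\<close>

definition S :: "real \<Rightarrow> nat \<Rightarrow> nat \<Rightarrow> real" where
  "S e k j = integral\<^sup>L lborel (\<lambda>z. if e < \<bar>z\<bar> then mellin_kernel b k ((2 * real j + 1) / r) z else 0)"

text \<open>The partial fractions are applied inside the cut integral, so \<open>g\<close> is cut as
  well although it is integrable by itself; this function of \<open>e\<close> and \<open>v\<close>
  stands in for the constant integral of \<open>g\<close> until the limit.\<close>

definition A :: "real \<Rightarrow> real \<Rightarrow> real" where
  "A e v = integral\<^sup>L lborel (\<lambda>u. if e < \<bar>r * u - v\<bar> then g u else 0)"

lemma exponent_bounds:
  assumes "j < n"
  shows "0 < (2 * real j + 1) / r" "(2 * real j + 1) / r < 1"
  using assms by (auto simp: r_def)

text \<open>The shift \<open>z = r * u - v\<close> straightens the strip, and the binomial expansion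
  of \<open>u ^ l = ((z + v) / r) ^ l\<close> separates \<open>z\<close> from \<open>v\<close>. One
  factor of \<open>r ^ Suc l\<close> is the Jacobian.\<close>

lemma inner_term:
  assumes e: "e > 0" and j: "j < n"
  shows "has_bochner_integral lborel
     (\<lambda>u. if e < \<bar>r * u - v\<bar> then u ^ l * exp ((2 * real j + 1) * u) / (1 - b * exp (r * u - v)) else 0)
     (exp ((2 * real j + 1) / r * v) / r ^ Suc l * (\<Sum>k\<le>l. real (l choose k) * v ^ (l - k) * S e k j))"
proof -
  define \<alpha> where "\<alpha> = (2 * real j + 1) / r"
  have \<alpha>: "0 < \<alpha>" "\<alpha> < 1" using exponent_bounds[OF j] by (auto simp: \<alpha>_def)
  have \<alpha>r: "\<alpha> * r = 2 * real j + 1" using r_pos by (simp add: \<alpha>_def)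
  let ?f = "\<lambda>z. exp (\<alpha> * v) / r ^ l * (\<Sum>k\<le>l. real (l choose k) * v ^ (l - k) * (if e < \<bar>z\<bar> then mellin_kernel b k \<alpha> z else 0))"
  have S: "has_bochner_integral lborel (\<lambda>z. if e < \<bar>z\<bar> then mellin_kernel b k \<alpha> z else 0) (S e k j)" for k
  proof -
    have "S e k j = integral\<^sup>L lborel (\<lambda>z. if e < \<bar>z\<bar> then mellin_kernel b k \<alpha> z else 0)"
      by (simp only: S_def \<alpha>_def)
    then show ?thesis
      using integrable_mellin_kernel_cut[OF b \<alpha> e, of k] by (simp add: has_bochner_integral_iff)
  qed
  have "has_bochner_integral lborel ?f
     (exp (\<alpha> * v) / r ^ l * (\<Sum>k\<le>l. real (l choose k) * v ^ (l - k) * S e k j))"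
    by (intro has_bochner_integral_mult_right has_bochner_integral_sum S)
  then have "has_bochner_integral lborel (\<lambda>u. ?f (- v + r * u))
     ((exp (\<alpha> * v) / r ^ l * (\<Sum>k\<le>l. real (l choose k) * v ^ (l - k) * S e k j)) /\<^sub>R \<bar>r\<bar>)"
    using r_pos by (intro lborel_has_bochner_integral_real_affine_iff[THEN iffD1]) auto
  moreover have "?f (- v + r * u) = (if e < \<bar>r * u - v\<bar> then u ^ l * exp ((2 * real j + 1) * u) / (1 - b * exp (r * u - v)) else 0)" for u
  proof (cases "e < \<bar>r * u - v\<bar>")
    case True
    have "(\<Sum>k\<le>l. real (l choose k) * v ^ (l - k) * mellin_kernel b k \<alpha> (r * u - v))
        = (\<Sum>k\<le>l. real (l choose k) * (r * u - v) ^ k * v ^ (l - k)) * (exp (\<alpha> * (r * u - v)) / (1 - b * exp (r * u - v)))"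
      unfolding sum_distrib_right by (intro sum.cong) (auto simp: mellin_kernel_def)
    also have "(\<Sum>k\<le>l. real (l choose k) * (r * u - v) ^ k * v ^ (l - k)) = ((r * u - v) + v) ^ l"
      by (rule binomial_ring[symmetric])
    also have "((r * u - v) + v) ^ l = r ^ l * u ^ l" by (simp add: power_mult_distrib)
    finally have "?f (- v + r * u) = exp (\<alpha> * v) / r ^ l * (r ^ l * u ^ l * (exp (\<alpha> * (r * u - v)) / (1 - b * exp (r * u - v))))"
      using True by simp
    also have "\<dots> = u ^ l * (exp (\<alpha> * v) * exp (\<alpha> * (r * u - v))) / (1 - b * exp (r * u - v))"
      using r_pos by simp
    also have "exp (\<alpha> * v) * exp (\<alpha> * (r * u - v)) = exp ((2 * real j + 1) * u)"
    proof -
      have "\<alpha> * v + \<alpha> * (r * u - v) = \<alpha> * r * u" by (simp add: algebra_simps)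
      then show ?thesis by (simp only: exp_add[symmetric] \<alpha>r)
    qed
    finally show ?thesis using True by simp
  qed auto
  ultimately show ?thesis
    using r_pos by (simp add: \<alpha>_def field_simps)
qed

text \<open>This is \<open>partial_fraction\<close> at \<open>X = exp u\<close>,
  \<open>y = exp (- v)\<close>. The three assumptions keep the denominators
  \<open>1 - c * y\<close>, \<open>1 - a * exp (2 * u)\<close> and
  \<open>1 - b * exp (r * u - v)\<close> away from 0, in this order.\<close>

lemma inner_integrand:
  assumes v: "v > 0" and u: "u \<noteq> 0" and uv: "r * u - v \<noteq> 0"
  shows "b * (g u * kern b (r * u - v)) = exp (- v) * c / (1 - c * exp (- v)) *
    (g u - (\<Sum>j<n. a ^ j * (u ^ l * exp ((2 * real j + 1) * u) / (1 - b * exp (r * u - v)))))"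
proof -
  have aa: "a * a = 1" using a by auto
  let ?X = "exp u" and ?y = "exp (- v)"
  have X2: "?X\<^sup>2 = exp (2 * u)" by (simp add: exp_double)
  have Xr: "?X ^ (2 * n) = exp (r * u)" by (simp add: r_def exp_of_nat_mult[symmetric])
  have Xry: "b * ?y * exp (r * u) = b * exp (r * u - v)" by (simp add: exp_diff exp_minus divide_inverse)
  have nz: "1 - a * exp (2 * u) \<noteq> 0" "1 - b * exp (r * u - v) \<noteq> 0" "1 - c * ?y \<noteq> 0"
    using one_minus_exp_nonzero[OF a] one_minus_exp_nonzero[OF b] one_minus_exp_nonzero[OF c] u uv v by auto
  have pf: "b * exp (r * u) / ((1 - a * exp (2 * u)) * (1 - b * exp (r * u - v)))
    = c / (1 - c * ?y) * (1 / (1 - a * exp (2 * u)) - (\<Sum>j<n. a ^ j * ?X ^ (2 * j)) / (1 - b * exp (r * u - v)))"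
    using partial_fraction[OF aa, of ?X b ?y n] nz unfolding X2 Xr Xry c_def by simp
  have "b * (g u * kern b (r * u - v)) = u ^ l * ?X * ?y * (b * exp (r * u) / ((1 - a * exp (2 * u)) * (1 - b * exp (r * u - v))))"
    by (simp add: g_def kern_def exp_diff exp_minus divide_inverse)
  also have "\<dots> = exp (- v) * c / (1 - c * exp (- v)) *
     (g u - u ^ l * ?X * ((\<Sum>j<n. a ^ j * ?X ^ (2 * j)) / (1 - b * exp (r * u - v))))"
  proof -
    have "P * y * (C / D * (1 / d - s / k)) = y * C / D * (P / d - P * (s / k))" for P y C D d s k :: real
      by (simp add: divide_inverse algebra_simps)
    then show ?thesis unfolding pf g_def .
  qed
  also have "u ^ l * ?X * ((\<Sum>j<n. a ^ j * ?X ^ (2 * j)) / (1 - b * exp (r * u - v))) =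
    (\<Sum>j<n. a ^ j * (u ^ l * exp ((2 * real j + 1) * u) / (1 - b * exp (r * u - v))))"
    unfolding sum_divide_distrib sum_distrib_left
  proof (intro sum.cong refl)
    fix j
    have "?X * ?X ^ (2 * j) = exp ((2 * real j + 1) * u)"
      by (simp add: exp_of_nat_mult[symmetric] exp_add[symmetric] algebra_simps)
    then show "u ^ l * ?X * (a ^ j * ?X ^ (2 * j) / (1 - b * exp (r * u - v))) =
      a ^ j * (u ^ l * exp ((2 * real j + 1) * u) / (1 - b * exp (r * u - v)))"
      by (simp add: mult_ac)
  qed
  finally show ?thesis .
qed

lemma inner_integral:
  assumes e: "e > 0" and v: "v > 0"
  shows "b * integral\<^sup>L lborel (\<lambda>u. H e u v) =
    v ^ i * (exp (- v) * c / (1 - c * exp (- v)) * (A e v -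
      (\<Sum>j<n. a ^ j * (exp ((2 * real j + 1) / r * v) / r ^ Suc l * (\<Sum>k\<le>l. real (l choose k) * v ^ (l - k) * S e k j)))))"
proof -
  let ?T = "\<lambda>j u. if e < \<bar>r * u - v\<bar> then u ^ l * exp ((2 * real j + 1) * u) / (1 - b * exp (r * u - v)) else 0"
  let ?f = "\<lambda>u. v ^ i * (exp (- v) * c / (1 - c * exp (- v)) *
       ((if e < \<bar>r * u - v\<bar> then g u else 0) - (\<Sum>j<n. a ^ j * ?T j u)))"
  have A: "has_bochner_integral lborel (\<lambda>u. if e < \<bar>r * u - v\<bar> then g u else 0) (A e v)"
  proof -
    have "integrable lborel (\<lambda>u. if e < \<bar>r * u - v\<bar> then g u else 0)"
      by (rule Bochner_Integration.integrable_bound[OF integrable_g]) auto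
    then show ?thesis by (simp add: has_bochner_integral_iff A_def)
  qed
  have f: "has_bochner_integral lborel ?f (v ^ i * (exp (- v) * c / (1 - c * exp (- v)) * (A e v -
      (\<Sum>j<n. a ^ j * (exp ((2 * real j + 1) / r * v) / r ^ Suc l * (\<Sum>k\<le>l. real (l choose k) * v ^ (l - k) * S e k j))))))"
    by (intro has_bochner_integral_mult_right has_bochner_integral_diff A has_bochner_integral_sum inner_term[OF e]) auto
  have "integral\<^sup>L lborel ?f = integral\<^sup>L lborel (\<lambda>u. b * H e u v)"
  proof (rule integral_cong_AE)
    show "AE u in lborel. ?f u = b * H e u v"
      using AE_lborel_singleton[of "0::real"]
    proof eventually_elim
      case (elim u)
      show ?case
      proof (cases "e < \<bar>r * u - v\<bar>")
        case True
        then have "b * H e u v = v ^ i * (b * (g u * kern b (r * u - v)))"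
          using v by (simp add: H_def)
        also have "b * (g u * kern b (r * u - v)) = exp (- v) * c / (1 - c * exp (- v)) *
            (g u - (\<Sum>j<n. a ^ j * (u ^ l * exp ((2 * real j + 1) * u) / (1 - b * exp (r * u - v)))))"
          using inner_integrand[OF v elim] True e by auto
        finally show ?thesis using True by simp
      qed (simp add: H_def)
    qed
  qed (auto simp: H_def)
  then have "integral\<^sup>L lborel ?f = b * integral\<^sup>L lborel (\<lambda>u. H e u v)"
    by (simp only: integral_mult_right_zero)
  then show ?thesis
    using has_bochner_integral_integral_eq[OF f] by (simp only:)
qed

lemma A_bound: "\<bar>A e v\<bar> \<le> integral\<^sup>L lborel (\<lambda>u. \<bar>g u\<bar>)"
proof -
  have "integrable lborel (\<lambda>u. if e < \<bar>r * u - v\<bar> then g u else 0)"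
    by (rule Bochner_Integration.integrable_bound[OF integrable_g]) auto
  from Bochner_Integration.integral_norm_bound_integral[OF this integrable_abs[OF integrable_g]]
  show ?thesis by (simp add: A_def)
qed

lemma measurable_A [measurable]: "A e \<in> borel_measurable borel"
  unfolding A_def [abs_def] by measurable

lemma A_tendsto: "(\<lambda>m. A (1 / real (Suc m)) v) \<longlonglongrightarrow> integral\<^sup>L lborel g"
  unfolding A_def
proof (rule integral_cut_tendsto[OF integrable_g])
  show "AE u in lborel. r * u - v \<noteq> 0"
    using AE_lborel_singleton[of "v / r"] by eventually_elim (use r_pos in \<open>auto simp: field_simps\<close>)
qed auto

lemma S_tendsto:
  assumes j: "j < n"
  shows "(\<lambda>m. S (1 / real (Suc m)) k j) \<longlonglongrightarrow> (- 1) ^ k * fact k * lerch_theta b (Suc k) (2 * real j + 1) r"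
  unfolding S_def by (rule mellin_kernel_cut_tendsto[OF b]) (use j in \<open>auto simp: r_def\<close>)

text \<open>\<open>exp (- v) * exp (\<alpha> * v)\<close> decays at rate
  \<open>1 - \<alpha>\<close>, which becomes the argument of \<Phi>, and the binomial power
  \<open>v ^ (l - k)\<close> raises its order. For \<open>c = 1\<close> the exponent
  \<open>i + l - k\<close> is positive since \<open>i \<noteq> 0\<close>.\<close>

lemma outer_term:
  assumes j: "j < n" and k: "k \<le> l"
  shows "has_bochner_integral lborel
    (\<lambda>v. indicator {0<..} v * (v ^ i * (exp (- v) / (1 - c * exp (- v)) * (exp ((2 * real j + 1) / r * v) * v ^ (l - k)))))
    (fact (i + l - k) * lerch_phi c (Suc (i + l - k)) (1 - (2 * real j + 1) / r))"
proof -
  define \<alpha> where "\<alpha> = (2 * real j + 1) / r"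
  have "has_bochner_integral lborel (\<lambda>v. indicator {0<..} v * (v ^ (i + l - k) * exp (- ((1 - \<alpha>) * v)) / (1 - c * exp (- v))))
    (fact (i + l - k) * lerch_phi c (Suc (i + l - k)) (1 - \<alpha>))"
    by (rule has_bochner_integral_lerch[OF c]) (use ci k exponent_bounds[OF j] in \<open>auto simp: c_def \<alpha>_def\<close>)
  moreover have "v ^ (i + l - k) * exp (- ((1 - \<alpha>) * v)) / (1 - c * exp (- v)) =
      v ^ i * (exp (- v) / (1 - c * exp (- v)) * (exp (\<alpha> * v) * v ^ (l - k)))" for v :: real
  proof -
    have "exp (- ((1 - \<alpha>) * v)) = exp (- v) * exp (\<alpha> * v)"
      by (simp add: exp_add[symmetric] algebra_simps)
    moreover have "v ^ (i + l - k) = v ^ i * v ^ (l - k)" using k by (simp add: power_add[symmetric])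
    ultimately show ?thesis by simp
  qed
  ultimately show ?thesis by (simp only: \<alpha>_def)
qed

lemma outer_lead:
  "has_bochner_integral lborel (\<lambda>v. indicator {0<..} v * (v ^ i * (exp (- v) / (1 - c * exp (- v)))))
     (fact i * lerch_phi c (Suc i) 1)"
proof -
  have "has_bochner_integral lborel (\<lambda>v. indicator {0<..} v * (v ^ i * exp (- (1 * v)) / (1 - c * exp (- v))))
     (fact i * lerch_phi c (Suc i) 1)"
    by (rule has_bochner_integral_lerch[OF c]) (use ci in \<open>auto simp: c_def\<close>)
  then show ?thesis by simp
qed

definition double_sum :: "(nat \<Rightarrow> nat \<Rightarrow> real) \<Rightarrow> real" where
  "double_sum s = (\<Sum>j<n. \<Sum>k\<le>l. a ^ j / r ^ Suc l * real (l choose k) * s k j *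
     (fact (i + l - k) * lerch_phi c (Suc (i + l - k)) (1 - (2 * real j + 1) / r)))"

lemma outer_integral:
  assumes e: "e > 0"
  shows "b * integral\<^sup>L lborel (\<lambda>u. g u * cut_polylog b i e (r * u)) =
    c * (integral\<^sup>L lborel (\<lambda>v. indicator {0<..} v * (v ^ i * (exp (- v) / (1 - c * exp (- v)))) * A e v)
      - double_sum (S e))"
proof -
  define w where "w = (\<lambda>v::real. indicator {0<..} v * (v ^ i * (exp (- v) / (1 - c * exp (- v)))) :: real)"
  define T where "T = (\<lambda>j k v::real. indicator {0<..} v * (v ^ i * (exp (- v) / (1 - c * exp (- v)) * (exp ((2 * real j + 1) / r * v) * v ^ (l - k)))) :: real)"
  have [measurable]: "w \<in> borel_measurable borel" unfolding w_def by measurable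
  have wA: "integrable lborel (\<lambda>v. w v * A e v)"
  proof (rule Bochner_Integration.integrable_bound)
    show "integrable lborel (\<lambda>v. w v * integral\<^sup>L lborel (\<lambda>u. \<bar>g u\<bar>))"
      using outer_lead unfolding w_def[symmetric]
      by (intro integrable_mult_left) (simp add: has_bochner_integral_iff)
    have "0 \<le> integral\<^sup>L lborel (\<lambda>u. \<bar>g u\<bar>)" by (rule integral_nonneg_AE) auto
    then show "AE v in lborel. norm (w v * A e v) \<le> norm (w v * integral\<^sup>L lborel (\<lambda>u. \<bar>g u\<bar>))"
      using A_bound[of e] by (auto simp: abs_mult intro!: mult_left_mono)
  qed auto
  have "b * integral\<^sup>L lborel (\<lambda>u. g u * cut_polylog b i e (r * u)) = integral\<^sup>L lborel (\<lambda>v. b * integral\<^sup>L lborel (\<lambda>u. H e u v))"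
    unfolding H_fubini[OF e] by simp
  also have "\<dots> = integral\<^sup>L lborel (\<lambda>v. c * (w v * A e v -
      (\<Sum>j<n. \<Sum>k\<le>l. a ^ j / r ^ Suc l * real (l choose k) * S e k j * T j k v)))"
  proof (rule Bochner_Integration.integral_cong[OF refl])
    fix v :: real
    show "b * integral\<^sup>L lborel (\<lambda>u. H e u v) = c * (w v * A e v -
      (\<Sum>j<n. \<Sum>k\<le>l. a ^ j / r ^ Suc l * real (l choose k) * S e k j * T j k v))"
    proof (cases "v > 0")
      case True
      define Q where "Q = v ^ i * (exp (- v) / (1 - c * exp (- v)))"
      have "b * integral\<^sup>L lborel (\<lambda>u. H e u v) = c * (Q * A e v - Q *
        (\<Sum>j<n. a ^ j * (exp ((2 * real j + 1) / r * v) / r ^ Suc l * (\<Sum>k\<le>l. real (l choose k) * v ^ (l - k) * S e k j))))"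
      proof -
        have "x * (y * c / D * (F - G)) = c * (x * (y / D) * F - x * (y / D) * G)" for x y D F G :: real
          by (simp add: divide_inverse algebra_simps)
        then show ?thesis unfolding inner_integral[OF e True] Q_def .
      qed
      also have "Q * (\<Sum>j<n. a ^ j * (exp ((2 * real j + 1) / r * v) / r ^ Suc l * (\<Sum>k\<le>l. real (l choose k) * v ^ (l - k) * S e k j)))
        = (\<Sum>j<n. \<Sum>k\<le>l. a ^ j / r ^ Suc l * real (l choose k) * S e k j * T j k v)"
        unfolding sum_distrib_left
      proof (intro sum.cong refl)
        fix j k
        have alg: "x * (y / D) * (z * (E / R * (B * V * s))) = z / R * B * s * (x * (y / D * (E * V)))" for x y D z E R B V s :: real
          by (simp add: divide_inverse mult_ac)
        show "Q * (a ^ j * (exp ((2 * real j + 1) / r * v) / r ^ Suc l * (real (l choose k) * v ^ (l - k) * S e k j)))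
          = a ^ j / r ^ Suc l * real (l choose k) * S e k j * T j k v"
          using True unfolding Q_def T_def alg by simp
      qed
      also have "Q = w v" using True by (simp add: Q_def w_def)
      finally show ?thesis .
    next
      case False
      then have "H e u v = 0" for u by (simp add: H_def)
      then show ?thesis using False by (simp add: w_def T_def)
    qed
  qed
  also have "\<dots> = c * (integral\<^sup>L lborel (\<lambda>v. w v * A e v) - double_sum (S e))"
    unfolding double_sum_def T_def
    by (intro has_bochner_integral_integral_eq has_bochner_integral_mult_right has_bochner_integral_diff
        has_bochner_integral_sum outer_term has_bochner_integral_integrable wA) auto
  finally show ?thesis unfolding w_def .
qed

subsection \<open>Removing the cut-off\<close>

text \<open>After the outer integration the cut-off survives only in \<open>A\<close>, treated by
  dominated convergence, and in finitely many constants \<open>S e k j\<close>, whose limits are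
  known.\<close>

lemma rhs_tendsto:
  "(\<lambda>m. b * integral\<^sup>L lborel (\<lambda>u. g u * cut_polylog b i (1 / real (Suc m)) (r * u))) \<longlonglongrightarrow>
     c * (fact i * lerch_phi c (Suc i) 1 * integral\<^sup>L lborel g
       - double_sum (\<lambda>k j. (- 1) ^ k * fact k * lerch_theta b (Suc k) (2 * real j + 1) r))"
proof -
  define w where "w = (\<lambda>v::real. indicator {0<..} v * (v ^ i * (exp (- v) / (1 - c * exp (- v)))) :: real)"
  have [measurable]: "w \<in> borel_measurable borel" unfolding w_def by measurable
  have w: "has_bochner_integral lborel w (fact i * lerch_phi c (Suc i) 1)"
    using outer_lead by (simp add: w_def)
  have outer: "b * integral\<^sup>L lborel (\<lambda>u. g u * cut_polylog b i (1 / real (Suc m)) (r * u)) =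
    c * (integral\<^sup>L lborel (\<lambda>v. w v * A (1 / real (Suc m)) v) - double_sum (S (1 / real (Suc m))))" for m
    unfolding w_def by (rule outer_integral) simp
  have "(\<lambda>m. integral\<^sup>L lborel (\<lambda>v. w v * A (1 / real (Suc m)) v)) \<longlonglongrightarrow> integral\<^sup>L lborel (\<lambda>v. w v * integral\<^sup>L lborel g)"
  proof (rule integral_dominated_convergence[where w = "\<lambda>v. \<bar>w v\<bar> * integral\<^sup>L lborel (\<lambda>u. \<bar>g u\<bar>)"])
    show "integrable lborel (\<lambda>v. \<bar>w v\<bar> * integral\<^sup>L lborel (\<lambda>u. \<bar>g u\<bar>))"
      using w by (auto simp: has_bochner_integral_iff)
    show "AE v in lborel. (\<lambda>m. w v * A (1 / real (Suc m)) v) \<longlonglongrightarrow> w v * integral\<^sup>L lborel g"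
      using A_tendsto by (intro AE_I2 tendsto_mult_left)
    show "AE v in lborel. norm (w v * A (1 / real (Suc m)) v) \<le> \<bar>w v\<bar> * integral\<^sup>L lborel (\<lambda>u. \<bar>g u\<bar>)" for m
      using A_bound by (auto simp: abs_mult intro!: mult_left_mono)
  qed measurable
  moreover have "(\<lambda>m. double_sum (S (1 / real (Suc m)))) \<longlonglongrightarrow> double_sum (\<lambda>k j. (- 1) ^ k * fact k * lerch_theta b (Suc k) (2 * real j + 1) r)"
    unfolding double_sum_def by (intro tendsto_sum tendsto_mult_right tendsto_mult_left S_tendsto) auto
  ultimately show ?thesis
    unfolding outer using has_bochner_integral_integral_eq[OF w] by (intro tendsto_mult_left tendsto_diff) auto
qed

text \<open>The limit on the polylogarithm side, where the uniform \<open>cut_polylog_bound\<close>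
  is needed. With \<open>t = 1 / (2 * r)\<close> its growth is
  \<open>exp (\<bar>u\<bar> / 2)\<close>, and multiplication by \<open>g\<close> leaves
  \<open>exp (- \<bar>u\<bar> / 2)\<close> in the majorant \<open>W\<close>.\<close>

lemma lhs_tendsto:
  defines "P \<equiv> \<lambda>u. g u * (b * fact i * polylog (Suc i) (b * exp (r * u)))"
  shows "integrable lborel P"
    and "(\<lambda>m. integral\<^sup>L lborel (\<lambda>u. g u * cut_polylog b i (1 / real (Suc m)) (r * u))) \<longlonglongrightarrow> integral\<^sup>L lborel P"
proof -
  define t where "t = 1 / (2 * r)"
  have t: "0 < t" "t \<le> 1" using n by (auto simp: t_def r_def)
  have r1: "r \<ge> 1" using n by (simp add: r_def)
  obtain C where C: "\<And>e s. 0 < e \<Longrightarrow> e \<le> 1 \<Longrightarrow> s \<noteq> 0 \<Longrightarrow>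
    \<bar>cut_polylog b i e s\<bar> \<le> C * (1 + \<bar>s\<bar>) ^ Suc i * (1 + \<bar>s\<bar> powr (- (1 / 2))) * exp (t * \<bar>s\<bar>)"
    using cut_polylog_bound[OF b t] by blast
  define W where "W = (\<lambda>u. \<bar>C\<bar> * r ^ Suc i * (1 + \<bar>u\<bar>) ^ (l + Suc i) * (1 + \<bar>u\<bar> powr (- (1 / 2))) * exp (- (1 / 2 * \<bar>u\<bar>)))"
  have Wn: "0 \<le> W u" for u using r1 by (simp add: W_def)
  have W: "integrable lborel W"
    by (rule integrable_exp_dominated[where C = "\<bar>C\<bar> * r ^ Suc i" and m = "l + Suc i" and c = "1 / 2"])
       (use Wn in \<open>auto simp: W_def\<close>)
  have bound: "\<bar>g u * cut_polylog b i e (r * u)\<bar> \<le> W u" if e: "0 < e" "e \<le> 1" and u: "u \<noteq> 0" for e u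
  proof -
    have "\<bar>cut_polylog b i e (r * u)\<bar> \<le> C * (1 + \<bar>r * u\<bar>) ^ Suc i * (1 + \<bar>r * u\<bar> powr (- (1 / 2))) * exp (t * \<bar>r * u\<bar>)"
      using C[OF e, of "r * u"] r_pos u by simp
    also have "\<dots> \<le> \<bar>C\<bar> * (r * (1 + \<bar>u\<bar>)) ^ Suc i * (1 + \<bar>u\<bar> powr (- (1 / 2))) * exp (1 / 2 * \<bar>u\<bar>)"
    proof (intro mult_mono power_mono)
      show "1 + \<bar>r * u\<bar> \<le> r * (1 + \<bar>u\<bar>)" using r1 by (simp add: abs_mult algebra_simps)
      have "\<bar>u\<bar> \<le> \<bar>r * u\<bar>" using r1 mult_right_mono[of 1 r "\<bar>u\<bar>"] by (simp add: abs_mult)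
      then show "1 + \<bar>r * u\<bar> powr (- (1 / 2)) \<le> 1 + \<bar>u\<bar> powr (- (1 / 2))"
        using u by (simp add: powr_mono2')
      show "exp (t * \<bar>r * u\<bar>) \<le> exp (1 / 2 * \<bar>u\<bar>)" using r_pos by (simp add: t_def abs_mult)
    qed (use r_pos in auto)
    finally have "\<bar>g u\<bar> * \<bar>cut_polylog b i e (r * u)\<bar> \<le> ((1 + \<bar>u\<bar>) ^ l * exp (- \<bar>u\<bar>)) *
       (\<bar>C\<bar> * (r * (1 + \<bar>u\<bar>)) ^ Suc i * (1 + \<bar>u\<bar> powr (- (1 / 2))) * exp (1 / 2 * \<bar>u\<bar>))"
      by (intro mult_mono g_bound[OF u]) auto
    also have "\<dots> = \<bar>C\<bar> * r ^ Suc i * ((1 + \<bar>u\<bar>) ^ l * (1 + \<bar>u\<bar>) ^ Suc i) * (1 + \<bar>u\<bar> powr (- (1 / 2))) * (exp (- \<bar>u\<bar>) * exp (1 / 2 * \<bar>u\<bar>))"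
      unfolding power_mult_distrib by (simp only: mult_ac)
    also have "exp (- \<bar>u\<bar>) * exp (1 / 2 * \<bar>u\<bar>) = exp (- (1 / 2 * \<bar>u\<bar>))"
      by (simp add: exp_add[symmetric])
    finally show ?thesis by (simp only: W_def abs_mult power_add)
  qed
  have nz: "AE u in lborel. u \<noteq> (0::real)" by (rule AE_lborel_singleton)
  have [measurable]: "cut_polylog b i e \<in> borel_measurable borel" for e
    unfolding cut_polylog_def [abs_def] by measurable
  have lim: "(\<lambda>m. g u * cut_polylog b i (1 / real (Suc m)) (r * u)) \<longlonglongrightarrow> P u" if "u \<noteq> 0" for u
    unfolding P_def using that r_pos by (intro tendsto_mult_left cut_polylog_tendsto[OF b]) auto
  \<comment> \<open>Measurability is inherited from the cut-off functions as a pointwise limit.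
    Convergence is known only for \<open>u \<noteq> 0\<close>, hence the patch at 0.\<close>
  have Pm: "P \<in> borel_measurable borel"
  proof -
    have "(\<lambda>u. if u = 0 then 0 else P u) \<in> borel_measurable borel"
    proof (rule borel_measurable_LIMSEQ_real)
      show "(\<lambda>m. if u = 0 then 0 else g u * cut_polylog b i (1 / real (Suc m)) (r * u)) \<longlonglongrightarrow> (if u = 0 then 0 else P u)" for u
        using lim by auto
    qed measurable
    then have "(\<lambda>u. if u = 0 then P 0 else (if u = 0 then 0 else P u)) \<in> borel_measurable borel"
      by measurable
    also have "(\<lambda>u. if u = 0 then P 0 else (if u = 0 then 0 else P u)) = P" by auto
    finally show ?thesis .
  qed
  have 1: "AE u in lborel. (\<lambda>m. g u * cut_polylog b i (1 / real (Suc m)) (r * u)) \<longlonglongrightarrow> P u"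
    using nz by eventually_elim (rule lim)
  have 2: "AE u in lborel. norm (g u * cut_polylog b i (1 / real (Suc m)) (r * u)) \<le> W u" for m
    using nz by eventually_elim (use bound in auto)
  have Pm': "P \<in> borel_measurable lborel" using Pm by simp
  have 3: "(\<lambda>u. g u * cut_polylog b i (1 / real (Suc m)) (r * u)) \<in> borel_measurable lborel" for m
    by measurable
  show "integrable lborel P"
    by (rule integrable_dominated_convergence[OF Pm' 3 W 1 2])
  show "(\<lambda>m. integral\<^sup>L lborel (\<lambda>u. g u * cut_polylog b i (1 / real (Suc m)) (r * u))) \<longlonglongrightarrow> integral\<^sup>L lborel P"
    by (rule integral_dominated_convergence[OF Pm' 3 W 1 2])
qed

lemma polylog_integral_log:
  "has_bochner_integral lborel (\<lambda>u. g u * polylog (Suc i) (b * exp (r * u)))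
     (c / fact i * (fact i * lerch_phi c (Suc i) 1 * integral\<^sup>L lborel g
       - double_sum (\<lambda>k j. (- 1) ^ k * fact k * lerch_theta b (Suc k) (2 * real j + 1) r)))"
proof -
  let ?P = "\<lambda>u. g u * (b * fact i * polylog (Suc i) (b * exp (r * u)))"
  let ?R = "c * (fact i * lerch_phi c (Suc i) 1 * integral\<^sup>L lborel g
       - double_sum (\<lambda>k j. (- 1) ^ k * fact k * lerch_theta b (Suc k) (2 * real j + 1) r))"
  have bb: "b * b = 1" using b by auto
  have "b * integral\<^sup>L lborel ?P = ?R"
    by (rule LIMSEQ_unique[OF tendsto_mult_left[OF lhs_tendsto(2)] rhs_tendsto])
  then have "b * ?R = (b * b) * integral\<^sup>L lborel ?P" by (simp only: mult.assoc)
  then have "integral\<^sup>L lborel ?P = b * ?R" by (simp only: bb mult_1_left)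
  with lhs_tendsto(1) have "has_bochner_integral lborel ?P (b * ?R)"
    unfolding has_bochner_integral_iff by (intro conjI)
  then have "has_bochner_integral lborel (\<lambda>u. b / fact i * ?P u) (b / fact i * (b * ?R))"
    by (rule has_bochner_integral_mult_right)
  moreover have "b / fact i * ?P u = g u * polylog (Suc i) (b * exp (r * u))" for u
  proof -
    have "b / fact i * ?P u = (b * b) * (g u * polylog (Suc i) (b * exp (r * u)))" by simp
    then show ?thesis by (simp only: bb mult_1_left)
  qed
  moreover have "b / fact i * (b * ?R) = (b * b) * (?R / fact i)" by simp
  moreover have "c / fact i * x = c * x / fact i" for x :: real by simp
  ultimately show ?thesis by (simp only: bb mult_1_left)
qed

end

section \<open>Return to the variable x\<close>

lemma has_integral_exp:
  fixes F :: "real \<Rightarrow> real"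
  assumes "has_bochner_integral lborel (\<lambda>u. F (exp u) * exp u) I"
  shows "(F has_integral I) {0<..}"
proof -
  have "(F has_integral I) (range exp)"
  proof (rule has_integral_change_of_variables)
    show "(exp has_field_derivative exp u) (at u within UNIV)" for u :: real
      by (auto intro!: derivative_eq_intros)
    show "has_bochner_integral lborel (\<lambda>u. indicator UNIV u * (\<bar>exp u\<bar> * F (exp u))) I"
      using assms by (simp add: mult.commute)
  qed (auto simp: inj_on_def)
  moreover have "range exp = {0::real<..}"
  proof (intro equalityI subsetI)
    fix y :: real
    assume "y \<in> {0<..}"
    then have "y = exp (ln y)" by simp
    then show "y \<in> range exp" by (rule image_eqI) simp
  qed auto
  ultimately show ?thesis by simp
qed

theorem theorem2:
  fixes p q n :: nat and a b :: real
  assumes "p \<ge> 1" and "q \<ge> 1" and "n \<ge> 1"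
    and "a \<in> {1, - 1}" and "b \<in> {1, - 1}"
    and "a ^ n * b = 1 \<Longrightarrow> p \<noteq> 1"
    and "a = 1 \<Longrightarrow> q \<noteq> 1"
  shows "((\<lambda>x. ln x ^ (q - 1) * polylog p (b * x ^ (2 * n)) / (1 - a * x\<^sup>2)) has_integral
      (- (a ^ (n - 1) * b * (1 / 2 ^ q) * fact (q - 1) * (1 + a * (- 1) ^ q)
            * lerch_phi a q (1 / 2) * lerch_phi (a ^ n * b) p 1)
       + a ^ (n - 1) * b * (1 / (2 * real n) ^ q) * fact (q - 1)
            * (\<Sum>j = 1..n. \<Sum>k = 1..q.
                 real ((p + q - k - 1) choose (p - 1)) * a ^ j * (- 1) ^ k
                 * lerch_theta b k (2 * real j - 1) (2 * real n)
                 * lerch_phi (a ^ n * b) (p + q - k)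
                     ((2 * real n - 2 * real j + 1) / (2 * real n)))))
    {0<..}"
proof -
  obtain i where p: "p = Suc i" using assms(1) by (cases p) auto
  obtain l where q: "q = Suc l" using assms(2) by (cases q) auto
  obtain N where N: "n = Suc N" using assms(3) by (cases n) auto
  have i0: "i \<noteq> 0" if "a ^ n * b = 1" using assms(6)[OF that] p by simp
  have l0: "l \<noteq> 0" if "a = 1" using assms(7)[OF that] q by simp
  interpret polylog_integral a b i l n
    by unfold_locales (fact assms(3-5) | erule i0 | erule l0)+
  have aa: "a * a = 1" using assms(4) by auto
  have n1: "n - 1 = N" and an: "a ^ n = a * a ^ N" by (simp_all add: N)
  have "(\<lambda>u. ln (exp u) ^ (q - 1) * polylog p (b * exp u ^ (2 * n)) / (1 - a * (exp u)\<^sup>2) * exp u)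
      = (\<lambda>u. g u * polylog (Suc i) (b * exp (r * u)))"
  proof
    fix u :: real
    have "(exp u)\<^sup>2 = exp (2 * u)" by (simp add: exp_double)
    moreover have "exp u ^ (2 * n) = exp (r * u)" by (simp add: r_def exp_of_nat_mult[symmetric])
    ultimately show "ln (exp u) ^ (q - 1) * polylog p (b * exp u ^ (2 * n)) / (1 - a * (exp u)\<^sup>2) * exp u
      = g u * polylog (Suc i) (b * exp (r * u))"
      by (simp add: g_def p q)
  qed
  then have 1: "((\<lambda>x. ln x ^ (q - 1) * polylog p (b * x ^ (2 * n)) / (1 - a * x\<^sup>2)) has_integral
     (c / fact i * (fact i * lerch_phi c (Suc i) 1 * integral\<^sup>L lborel g
       - double_sum (\<lambda>k j. (- 1) ^ k * fact k * lerch_theta b (Suc k) (2 * real j + 1) r)))) {0<..}"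
    using polylog_integral_log by (intro has_integral_exp) simp
  \<comment> \<open>Both Lerch arguments equal 1/2, and the cotangent clause is excluded because
    \<open>l \<noteq> 0\<close> when \<open>a = 1\<close>.\<close>
  have theta: "lerch_theta a (Suc l) 1 2 = (1 + a * (- 1) ^ q) * lerch_phi a q (1 / 2)"
    using al by (auto simp: lerch_theta_def q algebra_simps)
  have lead: "c / fact i * (fact i * lerch_phi c (Suc i) 1 * integral\<^sup>L lborel g) =
     - (a ^ (n - 1) * b * (1 / 2 ^ q) * fact (q - 1) * (1 + a * (- 1) ^ q)
            * lerch_phi a q (1 / 2) * lerch_phi (a ^ n * b) p 1)"
  proof -
    have ll: "(- 1) ^ l * (- 1) ^ l = (1 :: real)" by (simp flip: power_mult_distrib)
    \<comment> \<open>\<open>a * (- 1) ^ l\<close> is \<open>- (a * (- 1) ^ q)\<close> and squares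
      to 1, so multiplying the bracket by it merely changes the sign: the minus of the leading
      term.\<close>
    have "a * (- 1) ^ l * (1 + a * (- 1) ^ q) = a * (- 1) ^ l - (a * a) * ((- 1) ^ l * (- 1) ^ l)"
      by (simp add: q algebra_simps)
    also have "\<dots> = - (1 + a * (- 1) ^ q)" by (simp add: aa ll q)
    finally have key: "a * (- 1) ^ l * (1 + a * (- 1) ^ q) = - (1 + a * (- 1) ^ q)" .
    have "c / fact i * (fact i * lerch_phi c (Suc i) 1 * integral\<^sup>L lborel g) =
      a ^ N * b * (1 / 2 ^ q) * fact l * (a * (- 1) ^ l * (1 + a * (- 1) ^ q)) * lerch_phi a q (1 / 2) * lerch_phi c p 1"
      unfolding has_bochner_integral_integral_eq[OF has_bochner_integral_g] theta
      by (simp add: c_def an p q)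
    moreover have "q - 1 = l" by (simp add: q)
    ultimately show ?thesis unfolding key n1 c_def by (simp only: mult_minus_right mult_minus_left)
  qed
  define X where "X = (\<lambda>j k. real ((p + q - k - 1) choose (p - 1)) * a ^ j * (- 1) ^ k
                 * lerch_theta b k (2 * real j - 1) (2 * real n)
                 * lerch_phi (a ^ n * b) (p + q - k)
                     ((2 * real n - 2 * real j + 1) / (2 * real n)))"
  \<comment> \<open>Raising \<open>j\<close> and \<open>k\<close> by one turns
    \<open>c * a ^ j\<close> into \<open>a ^ (n - 1) * b * a ^ Suc j\<close> and costs a sign
    through \<open>(- 1) ^ Suc k\<close>; that sign cancels the minus in front of the double
    sum.\<close>
  have summand: "c / fact i * (a ^ j / r ^ Suc l * real (l choose k) * ((- 1) ^ k * fact k * lerch_theta b (Suc k) (2 * real j + 1) r) *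
     (fact (i + l - k) * lerch_phi c (Suc (i + l - k)) (1 - (2 * real j + 1) / r)))
     = - (a ^ (n - 1) * b * (1 / (2 * real n) ^ q) * fact (q - 1) * X (Suc j) (Suc k))"
    if k: "k \<le> l" for j k
  proof -
    have "real (i + l - k choose i) = fact (i + l - k) / (fact i * fact (l - k))"
      using k by (subst binomial_fact) auto
    moreover have "real (l choose k) = fact l / (fact k * fact (l - k))"
      using k by (rule binomial_fact)
    \<comment> \<open>\<open>fact k\<close> stems from the \<Theta> integral and
      \<open>fact (i + l - k)\<close> from the outer one; together they convert the coefficient of
      the binomial expansion into the one in the claim.\<close>
    ultimately have bin: "real (l choose k) * fact k * fact (i + l - k) / fact i = fact l * real (i + l - k choose i)"
      by simp
    have arg: "1 - (2 * real j + 1) / r = (2 * real n - 2 * real (Suc j) + 1) / (2 * real n)"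
      using n by (simp add: r_def field_simps)
    have idx: "p + q - Suc k - 1 = i + l - k" "p - 1 = i" "p + q - Suc k = Suc (i + l - k)" "2 * real (Suc j) - 1 = 2 * real j + 1"
      using k by (auto simp: p q)
    have "c / fact i * (a ^ j / r ^ Suc l * real (l choose k) * ((- 1) ^ k * fact k * lerch_theta b (Suc k) (2 * real j + 1) r) *
     (fact (i + l - k) * lerch_phi c (Suc (i + l - k)) (1 - (2 * real j + 1) / r)))
      = c * a ^ j / r ^ Suc l * (real (l choose k) * fact k * fact (i + l - k) / fact i) * (- 1) ^ k *
        lerch_theta b (Suc k) (2 * real j + 1) r * lerch_phi c (Suc (i + l - k)) (1 - (2 * real j + 1) / r)"
      by (simp add: mult_ac)
    also have "\<dots> = - (a ^ (n - 1) * b * (1 / (2 * real n) ^ q) * fact (q - 1) * X (Suc j) (Suc k))"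
      unfolding bin X_def idx arg by (simp add: c_def an n1[simplified] q r_def)
    finally show ?thesis .
  qed
  have "c / fact i * double_sum (\<lambda>k j. (- 1) ^ k * fact k * lerch_theta b (Suc k) (2 * real j + 1) r)
    = (\<Sum>j<n. \<Sum>k\<le>l. - (a ^ (n - 1) * b * (1 / (2 * real n) ^ q) * fact (q - 1) * X (Suc j) (Suc k)))"
    unfolding double_sum_def sum_distrib_left by (intro sum.cong refl summand) auto
  also have "\<dots> = - (a ^ (n - 1) * b * (1 / (2 * real n) ^ q) * fact (q - 1) * (\<Sum>j<n. \<Sum>k\<le>l. X (Suc j) (Suc k)))"
    by (simp only: sum_negf sum_distrib_left)
  also have "(\<Sum>j<n. \<Sum>k\<le>l. X (Suc j) (Suc k)) = (\<Sum>j = 1..n. \<Sum>k = 1..q. X j k)"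
  proof -
    have s: "(\<Sum>k\<le>M. f (Suc k)) = (\<Sum>k = 1..Suc M. f k)" for f :: "nat \<Rightarrow> real" and M
      by (rule sum.reindex_bij_witness[of _ "\<lambda>k. k - 1" Suc]) auto
    show ?thesis unfolding N q lessThan_Suc_atMost s by (rule s)
  qed
  finally have double: "c / fact i * double_sum (\<lambda>k j. (- 1) ^ k * fact k * lerch_theta b (Suc k) (2 * real j + 1) r)
    = - (a ^ (n - 1) * b * (1 / (2 * real n) ^ q) * fact (q - 1) * (\<Sum>j = 1..n. \<Sum>k = 1..q. X j k))" .
  show ?thesis
    using 1 unfolding right_diff_distrib lead double X_def by (simp only: diff_minus_eq_add)
qed

end
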